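(* Let $\mathbb K$ be a field, $R$ a polynomial ring over $\mathbb K$ whose variables are the vertices of a complete bipartite graph, and let $I\subseteq R$ be the edge ideal of this complete bipartite graph. Then $I$ admits a minimal pruned resolution.
   Context: The edge ideal of a simple graph is the ideal generated by the products of two variables corresponding to the edges. For a complete bipartite graph on vertices $\{x_1,\dots,x_n\}\sqcup\{y_1,\dots,y_m\}$ it is generated by all $x_iy_j$. $G(I)$ denotes the set of minimal monomial generators of a monomial ideal $I$. Multidegrees below are taken in $\mathbb Z^N$, $N$ the number of variables of $R$. Pruned resolutions. For a monomial ideal $I$ with minimal generators in a fixed order $m_1,\dots,m_q$ and $\sigma\subseteq\{1,\dots,q\}$ put $m_\sigma=\mathrm{lcm}(m_i: i\in\sigma)$, $m_\emptyset=1$. The Taylor resolution of $R/I$ is supported on the full simplex $X_{\mathrm{Taylor}}$ on $q$ vertices; the face $\sigma$ has homological degree $|\sigma|$ and multidegree the exponent of $m_\sigma$. Pruning algorithm: for $j=1,\dots,q$ successively (step $j$), for every $\sigma\not\ni j$ with $m_\sigma=m_{\sigma\cup\{j\}}$ and such that neither $\sigma$ nor $\sigma\cup\{j\}$ belongs to a previously selected edge, select (prune) the edge $\{\sigma,\sigma\cup\{j\}\}$. The selected edges form a homogeneous acyclic matching on $X_{\mathrm{Taylor}}$, and discrete Morse theory (Batzies–Welker) yields a $\mathbb Z^N$-graded CW-complex, with cells corresponding to the faces in no selected edge (critical faces), supporting a free resolution of $R/I$: the pruned resolution for the given order. Its module in homological degree $i$ is the direct sum of $R(-\deg m_\sigma)$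 over critical $\sigma$ with $|\sigma|=i$; so it is minimal iff, for all $i,\alpha$, the number of critical $\sigma$ with $|\sigma|=i$ and multidegree $\alpha$ is $\beta_{i,\alpha}(R/I)$. Betti splitting version. $I=J+K$, with $G(I)$ the disjoint union of $G(J)$ and $G(K)$, is a Betti splitting if $\beta_{i,\alpha}(I)=\beta_{i,\alpha}(J)+\beta_{i,\alpha}(K)+\beta_{i-1,\alpha}(J\cap K)$ for all $i$ and $\alpha\in\mathbb Z^N$. Then one may prune separately the faces with vertices in $G(J)$, the faces with vertices in $G(K)$, and the remaining faces (which account for $J\cap K$), and iterate this using Betti splittings of $J$, $K$, $J\cap K$; this is always a partial pruning of $X_{\mathrm{Taylor}}$, and the numbers of generators (pruned Betti numbers) satisfy $\overline\beta_{i,\alpha}(I)=\overline\beta_{i,\alpha}(J)+\overline\beta_{i,\alpha}(K)+\overline\beta_{i-1,\alpha}(J\cap K)$. $I$ admits a minimal pruned resolution if, for some order of the generators, the cellular resolution given by the pruning algorithm or by its iterated Betti splitting version is minimal. Explicitly (recursively, in finitely many steps): either for some order of $G(I)$ the pruned resolution of $R/I$ is minimal, or there is a Betti splitting $I=J+K$ such that $J$, $K$ and $J\cap K$ all admit minimal pruned resolutions. *)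

theory Defs
  imports
    "HOL-Library.Poly_Mapping"
    "HOL-Library.Function_Algebras"
    "Jordan_Normal_Form.Matrix_Kernel"
begin

section \<open>Polynomials and monomial ideals\<close>

text \<open>For a finite type \<open>'v\<close> of variables, exponent vectors are functions \<open>'v \<Rightarrow> nat\<close> with
  pointwise addition, and the polynomial ring is the corresponding monoid algebra. The pointwise
  order on exponent vectors is divisibility of monomials.\<close>

type_synonym ('v, 'k) mpoly = "('v \<Rightarrow> nat) \<Rightarrow>\<^sub>0 'k"

definition power_product :: "('v \<Rightarrow> nat) \<Rightarrow> ('v, 'k::field) mpoly" where
  "power_product a = Poly_Mapping.single a 1"

definition var :: "'v \<Rightarrow> ('v, 'k::field) mpoly" where
  "var u = power_product (\<lambda>v. if v = u then 1 else 0)"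

definition ideal_gen :: "('v, 'k::field) mpoly set \<Rightarrow> ('v, 'k) mpoly set" where
  "ideal_gen B = Modules.module.span (*) B"

definition monomial_ideal :: "('v, 'k::field) mpoly set \<Rightarrow> bool" where
  "monomial_ideal I \<longleftrightarrow> (\<exists>A. I = ideal_gen (power_product ` A))"

text \<open>\<open>G(I)\<close>, given by exponent vectors.\<close>

definition min_gens :: "('v, 'k::field) mpoly set \<Rightarrow> ('v \<Rightarrow> nat) set" where
  "min_gens I = {a. power_product a \<in> I \<and> (\<forall>b. power_product b \<in> I \<longrightarrow> b \<le> a \<longrightarrow> b = a)}"

section \<open>Multigraded free resolutions and Betti numbers\<close>

definition multidegree :: "('v \<Rightarrow> nat) \<Rightarrow> ('v \<Rightarrow> int)" where
  "multidegree a = (\<lambda>v. int (a v))"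

definition homogeneous :: "('v \<Rightarrow> int) \<Rightarrow> ('v, 'k::field) mpoly \<Rightarrow> bool" where
  "homogeneous \<alpha> p \<longleftrightarrow> (\<forall>a \<in> Poly_Mapping.keys p. multidegree a = \<alpha>)"

text \<open>A multigraded free resolution of the module \<open>P / Q\<close>, for ideals \<open>Q \<subseteq> P\<close>
  (so \<open>P = I\<close>, \<open>Q = 0\<close> gives \<open>I\<close>, and \<open>P = R\<close>, \<open>Q = I\<close> gives \<open>R/I\<close>):
  the \<open>i\<close>-th module is \<open>F\<^sub>i = \<Oplus>\<^sub>r R(- D i ! r)\<close>, the matrix \<open>d i\<close> represents \<open>F\<^sub>i\<^sub>+\<^sub>1 \<rightarrow> F\<^sub>i\<close>,
  and the augmentation \<open>F\<^sub>0 \<rightarrow> P / Q\<close> maps the \<open>r\<close>-th basis vector to the class of \<open>e $ r\<close>.\<close>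

definition graded_free_resolution ::
  "('v, 'k::field) mpoly set \<Rightarrow> ('v, 'k) mpoly set \<Rightarrow> (nat \<Rightarrow> ('v \<Rightarrow> int) list)
    \<Rightarrow> ('v, 'k) mpoly vec \<Rightarrow> (nat \<Rightarrow> ('v, 'k) mpoly mat) \<Rightarrow> bool" where
  "graded_free_resolution P Q D e d \<longleftrightarrow>
     e \<in> carrier_vec (length (D 0)) \<and>
     (\<forall>r < length (D 0). homogeneous (D 0 ! r) (e $ r)) \<and>
     (\<forall>i. d i \<in> carrier_mat (length (D i)) (length (D (Suc i)))) \<and>
     (\<forall>i. \<forall>r < length (D i). \<forall>c < length (D (Suc i)).
        homogeneous (D (Suc i) ! c - D i ! r) (d i $$ (r, c))) \<and>
     P = {e \<bullet> v + q | v q. v \<in> carrier_vec (length (D 0)) \<and> q \<in> Q} \<and>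
     {v \<in> carrier_vec (length (D 0)). e \<bullet> v \<in> Q}
       = (\<lambda>u. d 0 *\<^sub>v u) ` carrier_vec (length (D 1)) \<and>
     (\<forall>i. mat_kernel (d i) = (\<lambda>u. d (Suc i) *\<^sub>v u) ` carrier_vec (length (D (Suc (Suc i)))))"

text \<open>Minimality: the image of \<open>F\<^sub>i\<^sub>+\<^sub>1\<close> lies in the maximal homogeneous ideal times \<open>F\<^sub>i\<close>, that is,
  no matrix entry has a constant term.\<close>

definition minimal_graded_free_resolution ::
  "('v, 'k::field) mpoly set \<Rightarrow> ('v, 'k) mpoly set \<Rightarrow> (nat \<Rightarrow> ('v \<Rightarrow> int) list)
    \<Rightarrow> ('v, 'k) mpoly vec \<Rightarrow> (nat \<Rightarrow> ('v, 'k) mpoly mat) \<Rightarrow> bool" where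
  "minimal_graded_free_resolution P Q D e d \<longleftrightarrow>
     graded_free_resolution P Q D e d \<and>
     (\<forall>i. \<forall>r < length (D i). \<forall>c < length (D (Suc i)).
        Poly_Mapping.lookup (d i $$ (r, c)) 0 = 0)"

text \<open>\<open>betti P Q i \<alpha>\<close> is \<open>\<beta>\<^sub>i\<^sub>,\<^sub>\<alpha>(P / Q)\<close>, the number of summands \<open>R(-\<alpha>)\<close> in homological degree \<open>i\<close>
  of the minimal multigraded free resolution (unique up to isomorphism).\<close>

definition betti ::
  "('v, 'k::field) mpoly set \<Rightarrow> ('v, 'k) mpoly set \<Rightarrow> nat \<Rightarrow> ('v \<Rightarrow> int) \<Rightarrow> nat" where
  "betti P Q i \<alpha> =
     (THE n. \<exists>D e d. minimal_graded_free_resolution P Q D e d \<and> n = count_list (D i) \<alpha>)"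

definition betti_ideal :: "('v, 'k::field) mpoly set \<Rightarrow> nat \<Rightarrow> ('v \<Rightarrow> int) \<Rightarrow> nat" where
  "betti_ideal I = betti I {0}"

definition betti_quotient :: "('v, 'k::field) mpoly set \<Rightarrow> nat \<Rightarrow> ('v \<Rightarrow> int) \<Rightarrow> nat" where
  "betti_quotient I = betti UNIV I"

section \<open>The pruning algorithm\<close>

text \<open>Generators are listed as \<open>ms ! 0, \<dots>, ms ! (length ms - 1)\<close>; faces of the Taylor simplex are
  subsets of \<open>{..<length ms}\<close>, including the empty face.\<close>

definition face_lcm :: "('v \<Rightarrow> nat) list \<Rightarrow> nat set \<Rightarrow> ('v \<Rightarrow> nat)" where
  "face_lcm ms \<sigma> = (\<lambda>v. Max (insert 0 ((\<lambda>i. (ms ! i) v) ` \<sigma>)))"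

text \<open>\<open>pruned_edges ms j\<close> is the set of edges selected in the first \<open>j\<close> steps. Candidate edges within
  one step are pairwise disjoint, so they do not block each other.\<close>

primrec pruned_edges :: "('v \<Rightarrow> nat) list \<Rightarrow> nat \<Rightarrow> nat set set set" where
  "pruned_edges ms 0 = {}"
| "pruned_edges ms (Suc j) = pruned_edges ms j \<union>
     {{\<sigma>, insert j \<sigma>} | \<sigma>. \<sigma> \<subseteq> {..<length ms} \<and> j \<notin> \<sigma> \<and>
        face_lcm ms \<sigma> = face_lcm ms (insert j \<sigma>) \<and>
        \<sigma> \<notin> \<Union>(pruned_edges ms j) \<and> insert j \<sigma> \<notin> \<Union>(pruned_edges ms j)}"

definition critical_faces :: "('v \<Rightarrow> nat) list \<Rightarrow> nat set set" where
  "critical_faces ms = Pow {..<length ms} - \<Union>(pruned_edges ms (length ms))"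

definition pruned_betti :: "('v \<Rightarrow> nat) list \<Rightarrow> nat \<Rightarrow> ('v \<Rightarrow> int) \<Rightarrow> nat" where
  "pruned_betti ms i \<alpha> =
     card {\<sigma> \<in> critical_faces ms. card \<sigma> = i \<and> multidegree (face_lcm ms \<sigma>) = \<alpha>}"

text \<open>The pruned resolution of \<open>R/I\<close> has \<open>pruned_betti ms i \<alpha>\<close> summands \<open>R(-\<alpha>)\<close> in homological
  degree \<open>i\<close>, so it is minimal iff these numbers are the Betti numbers of \<open>R/I\<close>.\<close>

definition minimal_pruned_resolution ::
  "('v, 'k::field) mpoly set \<Rightarrow> ('v \<Rightarrow> nat) list \<Rightarrow> bool" where
  "minimal_pruned_resolution I ms \<longleftrightarrow>
     distinct ms \<and> set ms = min_gens I \<and> (\<forall>i \<alpha>. pruned_betti ms i \<alpha> = betti_quotient I i \<alpha>)"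

definition betti_splitting ::
  "('v, 'k::field) mpoly set \<Rightarrow> ('v, 'k) mpoly set \<Rightarrow> ('v, 'k) mpoly set \<Rightarrow> bool" where
  "betti_splitting I J K \<longleftrightarrow>
     monomial_ideal I \<and> monomial_ideal J \<and> monomial_ideal K \<and>
     I = {f + g | f g. f \<in> J \<and> g \<in> K} \<and>
     min_gens I = min_gens J \<union> min_gens K \<and> min_gens J \<inter> min_gens K = {} \<and>
     (\<forall>i \<alpha>. betti_ideal I i \<alpha> = betti_ideal J i \<alpha> + betti_ideal K i \<alpha> +
        (case i of 0 \<Rightarrow> 0 | Suc k \<Rightarrow> betti_ideal (J \<inter> K) k \<alpha>))"

inductive admits_minimal_pruned_resolution :: "('v, 'k::field) mpoly set \<Rightarrow> bool" where
  pruned: "monomial_ideal I \<Longrightarrow> minimal_pruned_resolution I ms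
    \<Longrightarrow> admits_minimal_pruned_resolution I"
| splitting: "betti_splitting I J K \<Longrightarrow> admits_minimal_pruned_resolution J
    \<Longrightarrow> admits_minimal_pruned_resolution K \<Longrightarrow> admits_minimal_pruned_resolution (J \<inter> K)
    \<Longrightarrow> admits_minimal_pruned_resolution I"

section \<open>Edge ideals\<close>

text \<open>A simple graph on the vertex set \<open>UNIV :: 'v set\<close> is given by its set of two-element edges.\<close>

definition edge_ideal :: "'v set set \<Rightarrow> ('v, 'k::field) mpoly set" where
  "edge_ideal E = ideal_gen {var u * var v | u v. {u, v} \<in> E}"

definition complete_bipartite :: "'v set set \<Rightarrow> bool" where
  "complete_bipartite E \<longleftrightarrow>
     (\<exists>X Y. X \<union> Y = UNIV \<and> X \<inter> Y = {} \<and> E = {{x, y} | x y. x \<in> X \<and> y \<in> Y})"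

end

theory Submission
  imports Defs
begin

text \<open>
  Order the generators \<open>x\<^sub>r y\<^sub>c\<close> row by row. A face of the Taylor simplex is a set of positions
  \<open>(r, c)\<close>, and pruning only compares faces with the same rows \<open>A\<close> and columns \<open>B\<close>, since these
  determine the lcm. For nonempty \<open>A\<close>, \<open>B\<close> exactly one face survives, the hook
  \<open>A \<times> {min B} \<union> {max A} \<times> B\<close> with \<open>|A| + |B| - 1\<close> elements. On the other side, \<open>R/I\<close> has the
  minimal resolution given by the Koszul complex modulo the faces lying on one side of the
  bipartition, which also has one generator for each pair of nonempty \<open>A\<close>, \<open>B\<close>, in degree
  \<open>|A| + |B| - 1\<close>. It is exact because each multigraded strand is the augmented relative chain
  complex of a simplex modulo two disjoint faces, contracted by cones. Betti numbers are independent
  of the minimal resolution because the comparison maps compose to the identity up to a null-homotopic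
  map, and such a map has no constant terms.
\<close>

section \<open>Homogeneous polynomials and matrices\<close>

text \<open>\<open>betti\<close> is a definite description, so an explicit minimal resolution
  determines its value only after all minimal resolutions are known to have the same numbers; hence
  the general homological algebra for quotients P / Q. Row-major order works because each row above
  the last can be settled before the next: whether one of its positions can still be toggled depends
  only on the row itself and on what lies below, so an invariant can be carried along the steps. On
  the algebraic side, a simplex modulo two disjoint nonempty faces is not acyclic: the two
  components leave a single class on the edges. The module R in homological degree 0 absorbs this
  class, and \<open>aug\<close> detects it. Both numbers to be compared are 0 or 1: apart from the
  empty face, a multidegree that occurs is that of a squarefree monomial, whose support determines
  A, B and the homological degree. So only two conditions on i and \<alpha> have to be
  matched.\<close>

lemma lookup_single_mult:
  fixes q :: "('v \<Rightarrow> nat) \<Rightarrow>\<^sub>0 'k::comm_ring_1"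
  shows "Poly_Mapping.lookup (Poly_Mapping.single b c * q) a = (if b \<le> a then c * Poly_Mapping.lookup q (a - b) else 0)"
proof -
  have *: "a = b + s \<longleftrightarrow> b \<le> a \<and> s = a - b" for s
  proof
    assume "a = b + s"
    then show "b \<le> a \<and> s = a - b"
      by (auto simp: le_fun_def fun_eq_iff)
  next
    assume "b \<le> a \<and> s = a - b"
    then show "a = b + s"
      by (auto simp: le_fun_def fun_eq_iff)
  qed
  have "Poly_Mapping.lookup (Poly_Mapping.single b c * q) a
      = Sum_any (\<lambda>l. c * Sum_any (\<lambda>s. Poly_Mapping.lookup q s when a = l + s) when l = b)"
    unfolding lookup_mult lookup_single
    by (intro arg_cong[of _ _ Sum_any] ext) (auto simp: when_def)
  also have "\<dots> = c * Sum_any (\<lambda>s. Poly_Mapping.lookup q s when a = b + s)"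
    by simp
  also have "(\<lambda>s. Poly_Mapping.lookup q s when a = b + s)
      = (\<lambda>s. (Poly_Mapping.lookup q s when b \<le> a) when s = a - b)"
    unfolding * by (intro ext) (auto simp: when_def)
  also have "Sum_any \<dots> = (Poly_Mapping.lookup q (a - b) when b \<le> a)"
    by simp
  finally show ?thesis
    by (simp add: when_def)
qed

lemma lookup_mult_0:
  fixes p q :: "('v \<Rightarrow> nat) \<Rightarrow>\<^sub>0 'k::comm_ring_1"
  shows "Poly_Mapping.lookup (p * q) 0 = Poly_Mapping.lookup p 0 * Poly_Mapping.lookup q 0"
proof -
  have *: "0 = l + s \<longleftrightarrow> l = 0 \<and> s = 0" for l s :: "'v \<Rightarrow> nat"
    by (auto simp: fun_eq_iff)
  have "Poly_Mapping.lookup (p * q) 0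
      = Sum_any (\<lambda>l. Poly_Mapping.lookup p l
          * Sum_any (\<lambda>s. Poly_Mapping.lookup q s when s = 0) when l = 0)"
    unfolding lookup_mult
    by (intro arg_cong[of _ _ Sum_any] ext) (auto simp: when_def *)
  then show ?thesis
    by simp
qed

lemma multidegree_eq_iff [simp]: "multidegree a = multidegree b \<longleftrightarrow> a = b"
  by (auto simp: multidegree_def fun_eq_iff)

lemma multidegree_0 [simp]: "multidegree 0 = 0"
  by (auto simp: multidegree_def fun_eq_iff)

lemma multidegree_add: "multidegree (a + b) = multidegree a + multidegree b"
  by (auto simp: multidegree_def fun_eq_iff)

lemma multidegree_diff: "b \<le> a \<Longrightarrow> multidegree (a - b) = multidegree a - multidegree b"
  by (auto simp: multidegree_def fun_eq_iff le_fun_def)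

lemma homogeneous_0 [simp]: "homogeneous \<alpha> 0"
  by (simp add: homogeneous_def)

lemma homogeneous_1 [simp]: "homogeneous 0 1"
  by (simp add: homogeneous_def)

lemma homogeneous_add: "homogeneous \<alpha> p \<Longrightarrow> homogeneous \<alpha> q \<Longrightarrow> homogeneous \<alpha> (p + q)"
  unfolding homogeneous_def using keys_add[of p q] by blast

lemma homogeneous_diff: "homogeneous \<alpha> p \<Longrightarrow> homogeneous \<alpha> q \<Longrightarrow> homogeneous \<alpha> (p - q)"
  unfolding homogeneous_def using keys_diff[of p q] by blast

lemma homogeneous_mult:
  assumes "homogeneous \<alpha> p" "homogeneous \<beta> q" shows "homogeneous (\<alpha> + \<beta>) (p * q)"
  using assms keys_mult[of p q] unfolding homogeneous_def
  by (fastforce simp: multidegree_add)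

lemma homogeneous_sum:
  "(\<And>x. x \<in> A \<Longrightarrow> homogeneous \<alpha> (f x)) \<Longrightarrow> homogeneous \<alpha> (sum f A)"
  by (induction A rule: infinite_finite_induct) (auto intro: homogeneous_add)

text \<open>Distinct monomials have distinct multidegrees, so every graded piece has dimension at
  most one. Products with a homogeneous factor thereby reduce to shifts of exponents.\<close>

lemma homogeneous_cases:
  assumes "homogeneous \<alpha> p"
  obtains "p = 0" | b c where "multidegree b = \<alpha>" "p = Poly_Mapping.single b c"
proof (cases "p = 0")
  case False
  then obtain b where b: "b \<in> Poly_Mapping.keys p"
    by (metis in_keys_iff lookup_zero poly_mapping_eqI)
  have "a = b" if "a \<in> Poly_Mapping.keys p" for a
    using assms that b unfolding homogeneous_def by (metis multidegree_eq_iff)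
  then have "p = Poly_Mapping.single b (Poly_Mapping.lookup p b)"
    by (intro poly_mapping_eqI) (metis in_keys_iff lookup_single_eq lookup_single_not_eq)
  moreover have "multidegree b = \<alpha>"
    using assms b by (auto simp: homogeneous_def)
  ultimately show ?thesis
    using that(2) by blast
qed (use that in blast)

lemma homogeneous_lookup_0: "homogeneous \<alpha> p \<Longrightarrow> Poly_Mapping.lookup p 0 \<noteq> 0 \<Longrightarrow> \<alpha> = 0"
  unfolding homogeneous_def by (drule bspec[of _ _ 0]) (auto simp: in_keys_iff)

lemma homogeneous_single: "homogeneous (multidegree a) (Poly_Mapping.single a c)"
  by (simp add: homogeneous_def)

definition hom_comp :: "('v \<Rightarrow> int) \<Rightarrow> ('v, 'k::field) mpoly \<Rightarrow> ('v, 'k) mpoly" where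
  "hom_comp \<alpha> p = Abs_poly_mapping (\<lambda>a. Poly_Mapping.lookup p a when multidegree a = \<alpha>)"

lemma lookup_hom_comp: "Poly_Mapping.lookup (hom_comp \<alpha> p) a = (Poly_Mapping.lookup p a when multidegree a = \<alpha>)"
proof -
  have "finite {a. (Poly_Mapping.lookup p a when multidegree a = \<alpha>) \<noteq> 0}"
    by (rule finite_subset[OF _ finite_lookup[of p]]) auto
  then show ?thesis
    by (simp add: hom_comp_def)
qed

lemma homogeneous_hom_comp: "homogeneous \<alpha> (hom_comp \<alpha> p)"
  by (auto simp: homogeneous_def in_keys_iff lookup_hom_comp)

lemma hom_comp_homogeneous: "homogeneous \<alpha> p \<Longrightarrow> hom_comp \<alpha> p = p"
  by (intro poly_mapping_eqI) (auto simp: homogeneous_def in_keys_iff lookup_hom_comp when_def)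

lemma hom_comp_0 [simp]: "hom_comp \<alpha> 0 = 0"
  by (intro poly_mapping_eqI) (auto simp: lookup_hom_comp when_def)

lemma hom_comp_add: "hom_comp \<alpha> (p + q) = hom_comp \<alpha> p + hom_comp \<alpha> q"
  by (intro poly_mapping_eqI) (auto simp: lookup_hom_comp lookup_add when_def)

lemma hom_comp_sum: "hom_comp \<alpha> (sum f A) = (\<Sum>x\<in>A. hom_comp \<alpha> (f x))"
  by (induction A rule: infinite_finite_induct) (auto simp: hom_comp_add)

text \<open>Multiplication by a single term only shifts degrees. The degree \<alpha> - \<gamma> may
  have negative entries; both sides are then zero.\<close>

lemma hom_comp_mult:
  assumes "homogeneous \<gamma> p"
  shows "hom_comp \<alpha> (p * q) = p * hom_comp (\<alpha> - \<gamma>) q"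
  using assms
proof (cases rule: homogeneous_cases)
  case (2 b c)
  show ?thesis
  proof (rule poly_mapping_eqI)
    fix a
    have "b \<le> a \<Longrightarrow> multidegree (a - b) = \<alpha> - \<gamma> \<longleftrightarrow> multidegree a = \<alpha>"
      using 2 by (auto simp: multidegree_diff)
    then show "Poly_Mapping.lookup (hom_comp \<alpha> (p * q)) a = Poly_Mapping.lookup (p * hom_comp (\<alpha> - \<gamma>) q) a"
      by (simp add: lookup_hom_comp 2 lookup_single_mult when_def)
  qed
qed simp

section \<open>Matrices that respect the multigrading\<close>

definition hom_mat ::
  "('v \<Rightarrow> int) list \<Rightarrow> ('v \<Rightarrow> int) list \<Rightarrow> ('v, 'k::field) mpoly mat \<Rightarrow> bool" where
  "hom_mat R C A \<longleftrightarrow> A \<in> carrier_mat (length R) (length C) \<and>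
     (\<forall>r < length R. \<forall>c < length C. homogeneous (C ! c - R ! r) (A $$ (r, c)))"

lemma hom_mat_carrier: "hom_mat R C A \<Longrightarrow> A \<in> carrier_mat (length R) (length C)"
  by (simp add: hom_mat_def)

lemma hom_mat_mult:
  assumes "hom_mat R C A" "hom_mat C S B" shows "hom_mat R S (A * B)"
  unfolding hom_mat_def
proof (intro conjI allI impI)
  show "A * B \<in> carrier_mat (length R) (length S)"
    using assms by (auto simp: hom_mat_def)
next
  fix r s assume rs: "r < length R" "s < length S"
  have "homogeneous (S ! s - R ! r) (A $$ (r, c) * B $$ (c, s))" if "c < length C" for c
    using homogeneous_mult[of "C ! c - R ! r" "A $$ (r, c)" "S ! s - C ! c" "B $$ (c, s)"]
      assms rs that by (auto simp: hom_mat_def)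
  then show "homogeneous (S ! s - R ! r) ((A * B) $$ (r, s))"
    using assms rs by (auto simp: hom_mat_def scalar_prod_def intro!: homogeneous_sum)
qed

lemma hom_mat_one: "hom_mat R R (1\<^sub>m (length R))"
  by (auto simp: hom_mat_def)

lemma hom_mat_diff:
  assumes "hom_mat R C A" "hom_mat R C B" shows "hom_mat R C (A - B)"
  using assms by (auto simp: hom_mat_def intro!: homogeneous_diff minus_carrier_mat)

text \<open>Arbitrary columnwise preimages can be made homogeneous: the entry \<open>u c $ s\<close>
  is replaced by its component of degree \<open>T ! c - S ! s\<close>. The equation survives because
  the entries of \<open>A\<close> and \<open>B\<close> are homogeneous, so that it splits by
  degree.\<close>

lemma hom_mat_lift:
  assumes A: "hom_mat R S A" and B: "hom_mat R T B"
    and img: "\<And>c. c < length T \<Longrightarrow> col B c \<in> (\<lambda>u. A *\<^sub>v u) ` carrier_vec (length S)"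
  shows "\<exists>C. hom_mat S T C \<and> A * C = B"
proof -
  have "\<exists>u \<in> carrier_vec (length S). c < length T \<longrightarrow> col B c = A *\<^sub>v u" for c
    using img[of c] by (cases "c < length T") (auto intro: zero_carrier_vec)
  then obtain u where u: "\<And>c. u c \<in> carrier_vec (length S)"
    "\<And>c. c < length T \<Longrightarrow> col B c = A *\<^sub>v u c"
    by metis
  define C where "C = mat (length S) (length T) (\<lambda>(s, c). hom_comp (T ! c - S ! s) (u c $ s))"
  have "hom_mat S T C"
    by (auto simp: hom_mat_def C_def homogeneous_hom_comp)
  moreover have "A * C = B"
  proof (rule eq_matI)
    fix r c assume "r < dim_row B" "c < dim_col B"
    then have rc: "r < length R" "c < length T"
      using B by (auto simp: hom_mat_def)
    note dims = hom_mat_carrier[OF A] hom_mat_carrier[OF B]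
    have "B $$ (r, c) = (\<Sum>s<length S. A $$ (r, s) * u c $ s)"
      using arg_cong[OF u(2)[OF rc(2)], of "\<lambda>v. v $ r"] rc dims u(1)[of c]
      by (auto simp: scalar_prod_def atLeast0LessThan intro!: sum.cong)
    then have "hom_comp (T ! c - R ! r) (B $$ (r, c))
        = (\<Sum>s<length S. hom_comp (T ! c - R ! r) (A $$ (r, s) * u c $ s))"
      by (simp add: hom_comp_sum)
    also have "\<dots> = (\<Sum>s<length S. A $$ (r, s) * hom_comp (T ! c - S ! s) (u c $ s))"
    proof (rule sum.cong)
      fix s assume "s \<in> {..<length S}"
      then have "homogeneous (S ! s - R ! r) (A $$ (r, s))"
        using A rc by (auto simp: hom_mat_def)
      then show "hom_comp (T ! c - R ! r) (A $$ (r, s) * u c $ s)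
          = A $$ (r, s) * hom_comp (T ! c - S ! s) (u c $ s)"
        by (simp add: hom_comp_mult)
    qed simp
    also have "\<dots> = (A * C) $$ (r, c)"
      using dims rc by (auto simp: C_def scalar_prod_def atLeast0LessThan intro!: sum.cong)
    finally show "(A * C) $$ (r, c) = B $$ (r, c)"
      using B rc by (simp add: hom_comp_homogeneous hom_mat_def)
  qed (use A B in \<open>auto simp: hom_mat_def C_def\<close>)
  ultimately show ?thesis by blast
qed

section \<open>Uniqueness of minimal graded free resolutions\<close>

text \<open>Closure under \<open>hom_comp\<close> allows an error term in Q to be replaced by its
  homogeneous component without leaving Q.\<close>

definition graded_ideal :: "('v, 'k::field) mpoly set \<Rightarrow> bool" where
  "graded_ideal Q \<longleftrightarrow> 0 \<in> Q \<and> (\<forall>p \<in> Q. \<forall>q \<in> Q. p + q \<in> Q) \<and> (\<forall>p \<in> Q. \<forall>r. r * p \<in> Q) \<and>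
     (\<forall>p \<in> Q. \<forall>\<alpha>. hom_comp \<alpha> p \<in> Q)"

lemma graded_ideal_sum: "graded_ideal Q \<Longrightarrow> (\<And>x. x \<in> A \<Longrightarrow> f x \<in> Q) \<Longrightarrow> sum f A \<in> Q"
  by (induction A rule: infinite_finite_induct) (auto simp: graded_ideal_def)

lemma resolution_vec:
  assumes "graded_free_resolution P Q D e d"
  shows "e \<in> carrier_vec (length (D 0))"
    and "r < length (D 0) \<Longrightarrow> homogeneous (D 0 ! r) (e $ r)"
  using assms by (auto simp: graded_free_resolution_def)

lemma resolution_augmentation:
  assumes "graded_free_resolution P Q D e d"
  shows "P = {e \<bullet> v + q | v q. v \<in> carrier_vec (length (D 0)) \<and> q \<in> Q}"
    and "{v \<in> carrier_vec (length (D 0)). e \<bullet> v \<in> Q}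
       = (\<lambda>u. d 0 *\<^sub>v u) ` carrier_vec (length (D 1))"
  using assms by (simp_all only: graded_free_resolution_def)

lemma resolution_hom_mat:
  assumes "graded_free_resolution P Q D e d"
  shows "hom_mat (D i) (D (Suc i)) (d i)"
  using assms by (simp add: graded_free_resolution_def hom_mat_def)

lemma resolution_carrier:
  assumes "graded_free_resolution P Q D e d"
  shows "d i \<in> carrier_mat (length (D i)) (length (D (Suc i)))"
  using hom_mat_carrier[OF resolution_hom_mat[OF assms]] .

lemma resolution_exact:
  assumes "graded_free_resolution P Q D e d"
  shows "mat_kernel (d i) = (\<lambda>u. d (Suc i) *\<^sub>v u) ` carrier_vec (length (D (Suc (Suc i))))"
  using assms by (simp add: graded_free_resolution_def)

lemma resolution_mult_vec_0:
  assumes "graded_free_resolution P Q D e d" "u \<in> carrier_vec (length (D (Suc (Suc i))))"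
  shows "d i *\<^sub>v (d (Suc i) *\<^sub>v u) = 0\<^sub>v (length (D i))"
proof -
  have "d (Suc i) *\<^sub>v u \<in> mat_kernel (d i)"
    unfolding resolution_exact[OF assms(1)] using assms(2) by (rule imageI)
  then show ?thesis
    using mat_kernelD[OF resolution_carrier[OF assms(1)]] by blast
qed

lemma mult_mat_col:
  assumes "A \<in> carrier_mat n m" "B \<in> carrier_mat m k" "c < k"
  shows "col (A * B) c = A *\<^sub>v col B c"
  using assms by (intro eq_vecI) auto

lemma mult_mat_vec_unit:
  fixes A :: "'a::comm_ring_1 mat"
  assumes "A \<in> carrier_mat n m" "c < m"
  shows "A *\<^sub>v unit_vec m c = col A c"
  using assms by (intro eq_vecI) auto

lemma mat_eq_0I:
  fixes A :: "'a::comm_ring_1 mat"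
  assumes A: "A \<in> carrier_mat n m" and 0: "\<And>u. u \<in> carrier_vec m \<Longrightarrow> A *\<^sub>v u = 0\<^sub>v n"
  shows "A = 0\<^sub>m n m"
proof (rule eq_matI)
  fix r c assume rc: "r < dim_row (0\<^sub>m n m :: 'a mat)" "c < dim_col (0\<^sub>m n m :: 'a mat)"
  then have "col A c = 0\<^sub>v n"
    using 0[of "unit_vec m c"] mult_mat_vec_unit[OF A, of c] by simp
  then have "col A c $ r = 0\<^sub>v n $ r"
    by simp
  then show "A $$ (r, c) = 0\<^sub>m n m $$ (r, c)"
    using A rc by simp
qed (use A in auto)

lemma resolution_mult_0:
  assumes "graded_free_resolution P Q D e d"
  shows "d i * d (Suc i) = 0\<^sub>m (length (D i)) (length (D (Suc (Suc i))))"
proof (rule mat_eq_0I)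
  note c = resolution_carrier[OF assms, of i] resolution_carrier[OF assms, of "Suc i"]
  show "d i * d (Suc i) \<in> carrier_mat (length (D i)) (length (D (Suc (Suc i))))"
    using c by auto
  fix u :: "('a, 'b) mpoly vec" assume "u \<in> carrier_vec (length (D (Suc (Suc i))))"
  then show "d i * d (Suc i) *\<^sub>v u = 0\<^sub>v (length (D i))"
    using assoc_mult_mat_vec[OF c, of u] resolution_mult_vec_0[OF assms, of u i] by simp
qed

section \<open>Comparison maps and null-homotopies\<close>

lemma comparison_map_0:
  assumes Q: "graded_ideal Q"
    and res: "graded_free_resolution P Q D e d" and res': "graded_free_resolution P Q D' e' d'"
  shows "\<exists>\<phi>. hom_mat (D' 0) (D 0) \<phi> \<and>
    (\<forall>w \<in> carrier_vec (length (D 0)). e' \<bullet> (\<phi> *\<^sub>v w) - e \<bullet> w \<in> Q)"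
proof -
  let ?n = "length (D 0)" and ?n' = "length (D' 0)"
  note e = resolution_vec[OF res] and e' = resolution_vec[OF res']
  \<comment> \<open>Basis vectors of the first resolution are lifted through the augmentation of the
    second. This is possible only up to an element of Q, because the resolved module is P /
    Q.\<close>
  have "\<exists>v q. c < ?n \<longrightarrow> v \<in> carrier_vec ?n' \<and> q \<in> Q \<and> e $ c = e' \<bullet> v + q" for c
  proof (cases "c < ?n")
    case True
    have "e $ c = e \<bullet> unit_vec ?n c + 0"
      using e(1) True by simp
    moreover have "0 \<in> Q"
      using Q by (simp add: graded_ideal_def)
    ultimately have "e $ c \<in> P"
      unfolding resolution_augmentation(1)[OF res] mem_Collect_eq using unit_vec_carrier by blast
    then show ?thesis
      unfolding resolution_augmentation(1)[OF res'] mem_Collect_eq by blast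
  qed simp
  then obtain v q where v: "\<And>c. c < ?n \<Longrightarrow> v c \<in> carrier_vec ?n'"
    and q: "\<And>c. c < ?n \<Longrightarrow> q c \<in> Q"
    and eq: "\<And>c. c < ?n \<Longrightarrow> e $ c = e' \<bullet> v c + q c"
    by metis
  define \<phi> where "\<phi> = mat ?n' ?n (\<lambda>(r, c). hom_comp (D 0 ! c - D' 0 ! r) (v c $ r))"
  have "hom_mat (D' 0) (D 0) \<phi>"
    by (auto simp: hom_mat_def \<phi>_def homogeneous_hom_comp)
  moreover have "e' \<bullet> (\<phi> *\<^sub>v w) - e \<bullet> w \<in> Q" if w: "w \<in> carrier_vec ?n" for w
  proof -
    \<comment> \<open>Comparing components of degree \<open>D 0 ! c\<close> makes the lift
      homogeneous and turns the error into a component of \<open>q c\<close>.\<close>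
    have col: "(\<Sum>r<?n'. e' $ r * \<phi> $$ (r, c)) = e $ c - hom_comp (D 0 ! c) (q c)"
      if c: "c < ?n" for c
    proof -
      have "e $ c = hom_comp (D 0 ! c) (e' \<bullet> v c + q c)"
        using e(2)[OF c] eq[OF c] by (simp add: hom_comp_homogeneous)
      also have "\<dots> = (\<Sum>r<?n'. hom_comp (D 0 ! c) (e' $ r * v c $ r)) + hom_comp (D 0 ! c) (q c)"
        using v[OF c] by (simp add: hom_comp_add hom_comp_sum scalar_prod_def atLeast0LessThan)
      also have "(\<Sum>r<?n'. hom_comp (D 0 ! c) (e' $ r * v c $ r)) = (\<Sum>r<?n'. e' $ r * \<phi> $$ (r, c))"
        using c e'(2) by (intro sum.cong) (auto simp: hom_comp_mult \<phi>_def)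
      finally show ?thesis
        by simp
    qed
    have "e' \<bullet> (\<phi> *\<^sub>v w) = (\<Sum>r<?n'. \<Sum>c<?n. e' $ r * \<phi> $$ (r, c) * w $ c)"
      using w by (auto simp: scalar_prod_def \<phi>_def atLeast0LessThan sum_distrib_left mult.assoc
          intro!: sum.cong)
    also have "\<dots> = (\<Sum>c<?n. (\<Sum>r<?n'. e' $ r * \<phi> $$ (r, c)) * w $ c)"
      by (subst sum.swap) (simp add: sum_distrib_right)
    also have "\<dots> = (\<Sum>c<?n. e $ c * w $ c + (- w $ c) * hom_comp (D 0 ! c) (q c))"
      by (intro sum.cong) (auto simp: col algebra_simps)
    also have "\<dots> = e \<bullet> w + (\<Sum>c<?n. (- w $ c) * hom_comp (D 0 ! c) (q c))"
      using w by (simp only: sum.distrib scalar_prod_def atLeast0LessThan carrier_vecD)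
    finally have "e' \<bullet> (\<phi> *\<^sub>v w) - e \<bullet> w = (\<Sum>c<?n. (- w $ c) * hom_comp (D 0 ! c) (q c))"
      by simp
    moreover have "\<dots> \<in> Q"
    proof (rule graded_ideal_sum[OF Q])
      fix c assume "c \<in> {..<?n}"
      then have "q c \<in> Q"
        using q by simp
      then have "hom_comp (D 0 ! c) (q c) \<in> Q"
        using Q unfolding graded_ideal_def by blast
      then show "(- w $ c) * hom_comp (D 0 ! c) (q c) \<in> Q"
        using Q unfolding graded_ideal_def by blast
    qed
    ultimately show ?thesis
      by simp
  qed
  ultimately show ?thesis
    by blast
qed

text \<open>Each matrix is chosen depending on the previous one. \<open>good\<close> keeps the fact
  that makes the next choice possible: \<open>\<phi>\<close> sends the image of \<open>d i\<close>
  into the image of \<open>d' i\<close>. In degree 0 this comes from compatibility with the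
  augmentations, later from exactness of the second resolution.\<close>

lemma comparison_map:
  assumes Q: "graded_ideal Q"
    and res: "graded_free_resolution P Q D e d" and res': "graded_free_resolution P Q D' e' d'"
  shows "\<exists>\<phi>. (\<forall>i. hom_mat (D' i) (D i) (\<phi> i)) \<and> (\<forall>i. d' i * \<phi> (Suc i) = \<phi> i * d i) \<and>
    (\<forall>w \<in> carrier_vec (length (D 0)). e' \<bullet> (\<phi> 0 *\<^sub>v w) - e \<bullet> w \<in> Q)"
proof -
  note car = resolution_carrier[OF res] and car' = resolution_carrier[OF res']
  define good where "good i \<phi> \<longleftrightarrow> hom_mat (D' i) (D i) \<phi> \<and>
    (\<forall>u \<in> carrier_vec (length (D (Suc i))). \<phi> *\<^sub>v (d i *\<^sub>v u)
        \<in> (\<lambda>u. d' i *\<^sub>v u) ` carrier_vec (length (D' (Suc i)))) \<and>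
    (i = 0 \<longrightarrow> (\<forall>w \<in> carrier_vec (length (D 0)). e' \<bullet> (\<phi> *\<^sub>v w) - e \<bullet> w \<in> Q))"
    for i and \<phi> :: "('a, 'b) mpoly mat"
  have "\<exists>\<phi>. \<forall>i. good i (\<phi> i) \<and> d' i * \<phi> (Suc i) = \<phi> i * d i"
  proof (rule dependent_nat_choice)
    obtain \<phi> where \<phi>: "hom_mat (D' 0) (D 0) \<phi>"
      and *: "\<And>w. w \<in> carrier_vec (length (D 0)) \<Longrightarrow> e' \<bullet> (\<phi> *\<^sub>v w) - e \<bullet> w \<in> Q"
      using comparison_map_0[OF Q res res'] by blast
    have "\<phi> *\<^sub>v (d 0 *\<^sub>v u) \<in> (\<lambda>u. d' 0 *\<^sub>v u) ` carrier_vec (length (D' 1))"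
      if u: "u \<in> carrier_vec (length (D 1))" for u
    proof -
      have "d 0 *\<^sub>v u \<in> {v \<in> carrier_vec (length (D 0)). e \<bullet> v \<in> Q}"
        unfolding resolution_augmentation(2)[OF res] using u by (rule imageI)
      then have w: "d 0 *\<^sub>v u \<in> carrier_vec (length (D 0))" and eQ: "e \<bullet> (d 0 *\<^sub>v u) \<in> Q"
        by simp_all
      have "e' \<bullet> (\<phi> *\<^sub>v (d 0 *\<^sub>v u)) - e \<bullet> (d 0 *\<^sub>v u) + e \<bullet> (d 0 *\<^sub>v u) \<in> Q"
        using Q *[OF w] eQ unfolding graded_ideal_def by blast
      then have "e' \<bullet> (\<phi> *\<^sub>v (d 0 *\<^sub>v u)) \<in> Q"
        by simp
      then show ?thesis
        using w hom_mat_carrier[OF \<phi>] unfolding resolution_augmentation(2)[OF res', symmetric] by auto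
    qed
    with \<phi> * show "\<exists>\<phi>. good 0 \<phi>"
      unfolding good_def by auto
  next
    fix \<phi> i assume good: "good i \<phi>"
    then have \<phi>: "hom_mat (D' i) (D i) \<phi>" by (simp add: good_def)
    note \<phi>c = hom_mat_carrier[OF \<phi>]
    have "col (\<phi> * d i) c \<in> (\<lambda>u. d' i *\<^sub>v u) ` carrier_vec (length (D' (Suc i)))"
      if "c < length (D (Suc i))" for c
    proof -
      have "\<phi> *\<^sub>v (d i *\<^sub>v unit_vec (length (D (Suc i))) c)
          \<in> (\<lambda>u. d' i *\<^sub>v u) ` carrier_vec (length (D' (Suc i)))"
        using good unfolding good_def by (elim conjE) (rule bspec[OF _ unit_vec_carrier])
      then show ?thesis
        by (simp only: mult_mat_col[OF \<phi>c car that] mult_mat_vec_unit[OF car that])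
    qed
    then obtain \<phi>' where \<phi>': "hom_mat (D' (Suc i)) (D (Suc i)) \<phi>'" and eq: "d' i * \<phi>' = \<phi> * d i"
      using hom_mat_lift[OF resolution_hom_mat[OF res'] hom_mat_mult[OF \<phi> resolution_hom_mat[OF res]]]
      by blast
    note \<phi>'c = hom_mat_carrier[OF \<phi>']
    have "\<phi>' *\<^sub>v (d (Suc i) *\<^sub>v u) \<in> mat_kernel (d' i)"
      if u: "u \<in> carrier_vec (length (D (Suc (Suc i))))" for u
    proof (rule mat_kernelI[OF car'])
      have w: "d (Suc i) *\<^sub>v u \<in> carrier_vec (length (D (Suc i)))"
        using car[of "Suc i"] u by auto
      then show "\<phi>' *\<^sub>v (d (Suc i) *\<^sub>v u) \<in> carrier_vec (length (D' (Suc i)))"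
        using \<phi>'c by auto
      have "d' i *\<^sub>v (\<phi>' *\<^sub>v (d (Suc i) *\<^sub>v u)) = \<phi> *\<^sub>v (d i *\<^sub>v (d (Suc i) *\<^sub>v u))"
        using assoc_mult_mat_vec[OF car' \<phi>'c w] assoc_mult_mat_vec[OF \<phi>c car w] eq by simp
      then show "d' i *\<^sub>v (\<phi>' *\<^sub>v (d (Suc i) *\<^sub>v u)) = 0\<^sub>v (length (D' i))"
        using resolution_mult_vec_0[OF res u] \<phi>c by auto
    qed
    then have "good (Suc i) \<phi>'"
      using \<phi>' unfolding good_def resolution_exact[OF res'] by auto
    with eq show "\<exists>\<phi>'. good (Suc i) \<phi>' \<and> d' i * \<phi>' = \<phi> * d i"
      by blast
  qed
  then show ?thesis
    unfolding good_def by blast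
qed

text \<open>The condition on the augmentation says that \<open>f\<close> induces zero on P / Q. Here
  \<open>good\<close> records that what \<open>h\<close> leaves over,
  \<open>f (Suc i) - h * d i\<close>, is killed by \<open>d i\<close>; exactness then provides the
  next \<open>h\<close>.\<close>

lemma null_homotopy:
  assumes res: "graded_free_resolution P Q D e d"
    and f: "\<And>i. hom_mat (D i) (D i) (f i)" and comm: "\<And>i. d i * f (Suc i) = f i * d i"
    and aug: "\<And>w. w \<in> carrier_vec (length (D 0)) \<Longrightarrow> e \<bullet> (f 0 *\<^sub>v w) \<in> Q"
  shows "\<exists>h. (\<forall>i. hom_mat (D (Suc i)) (D i) (h i)) \<and> d 0 * h 0 = f 0 \<and>
    (\<forall>i. d (Suc i) * h (Suc i) = f (Suc i) - h i * d i)"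
proof -
  note car = resolution_carrier[OF res] and fc = hom_mat_carrier[OF f]
  define good where "good i h \<longleftrightarrow> hom_mat (D (Suc i)) (D i) h \<and>
    d i * (f (Suc i) - h * d i) = 0\<^sub>m (length (D i)) (length (D (Suc i))) \<and>
    (i = 0 \<longrightarrow> d 0 * h = f 0)" for i and h :: "('a, 'b) mpoly mat"
  have "\<exists>h. \<forall>i. good i (h i) \<and> d (Suc i) * h (Suc i) = f (Suc i) - h i * d i"
  proof (rule dependent_nat_choice)
    have "col (f 0) c \<in> (\<lambda>u. d 0 *\<^sub>v u) ` carrier_vec (length (D (Suc 0)))"
      if "c < length (D 0)" for c
    proof -
      have "f 0 *\<^sub>v unit_vec (length (D 0)) c \<in> {v \<in> carrier_vec (length (D 0)). e \<bullet> v \<in> Q}"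
        using aug[of "unit_vec (length (D 0)) c"] fc[of 0] by auto
      then show ?thesis
        unfolding resolution_augmentation(2)[OF res] mult_mat_vec_unit[OF fc that] by simp
    qed
    then obtain h where h: "hom_mat (D (Suc 0)) (D 0) h" and eq: "d 0 * h = f 0"
      using hom_mat_lift[OF resolution_hom_mat[OF res] f] by metis
    note hc = hom_mat_carrier[OF h]
    have "d 0 * (f (Suc 0) - h * d 0) = d 0 * f (Suc 0) - d 0 * (h * d 0)"
      by (rule mult_minus_distrib_mat[OF car fc mult_carrier_mat[OF hc car]])
    also have "d 0 * (h * d 0) = f 0 * d 0"
      using assoc_mult_mat[OF car hc car] eq by simp
    finally have "d 0 * (f (Suc 0) - h * d 0) = 0\<^sub>m (length (D 0)) (length (D (Suc 0)))"
      using comm[of 0] fc[of 0] car[of 0] by auto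
    with h eq show "\<exists>h. good 0 h"
      unfolding good_def by blast
  next
    fix h i assume good: "good i h"
    then have h: "hom_mat (D (Suc i)) (D i) h"
      and 0: "d i * (f (Suc i) - h * d i) = 0\<^sub>m (length (D i)) (length (D (Suc i)))"
      by (simp_all add: good_def)
    let ?g = "f (Suc i) - h * d i"
    have g: "hom_mat (D (Suc i)) (D (Suc i)) ?g"
      by (intro hom_mat_diff f hom_mat_mult[OF h resolution_hom_mat[OF res]])
    note hc = hom_mat_carrier[OF h] and gc = hom_mat_carrier[OF g]
    have "col ?g c \<in> (\<lambda>u. d (Suc i) *\<^sub>v u) ` carrier_vec (length (D (Suc (Suc i))))"
      if "c < length (D (Suc i))" for c
      unfolding resolution_exact[OF res, symmetric]
    proof (rule mat_kernelI[OF car])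
      show "col ?g c \<in> carrier_vec (length (D (Suc i)))"
        using gc that by auto
      show "d i *\<^sub>v col ?g c = 0\<^sub>v (length (D i))"
        using mult_mat_col[OF car gc that] 0 that by simp
    qed
    then obtain h' where h': "hom_mat (D (Suc (Suc i))) (D (Suc i)) h'" and eq: "d (Suc i) * h' = ?g"
      using hom_mat_lift[OF resolution_hom_mat[OF res] g] by metis
    note hc' = hom_mat_carrier[OF h']
    have "d (Suc i) * (f (Suc (Suc i)) - h' * d (Suc i))
        = d (Suc i) * f (Suc (Suc i)) - d (Suc i) * (h' * d (Suc i))"
      by (rule mult_minus_distrib_mat[OF car fc mult_carrier_mat[OF hc' car]])
    also have "d (Suc i) * (h' * d (Suc i)) = ?g * d (Suc i)"
      using assoc_mult_mat[OF car hc' car] eq by simp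
    also have "\<dots> = f (Suc i) * d (Suc i) - h * d i * d (Suc i)"
      by (rule minus_mult_distrib_mat[OF fc mult_carrier_mat[OF hc car] car])
    also have "h * d i * d (Suc i) = 0\<^sub>m (length (D (Suc i))) (length (D (Suc (Suc i))))"
      using assoc_mult_mat[OF hc car car] resolution_mult_0[OF res, of i] hc by simp
    finally have "d (Suc i) * (f (Suc (Suc i)) - h' * d (Suc i))
        = 0\<^sub>m (length (D (Suc i))) (length (D (Suc (Suc i))))"
      unfolding comm using fc[of "Suc i"] car[of "Suc i"] by auto
    with h' eq show "\<exists>h'. good (Suc i) h' \<and> d (Suc i) * h' = ?g"
      unfolding good_def by blast
  qed
  then show ?thesis
    unfolding good_def by blast
qed

section \<open>Constant terms and numbers of summands\<close>

interpretation const: comm_ring_hom "\<lambda>p :: ('v \<Rightarrow> nat) \<Rightarrow>\<^sub>0 'k::comm_ring_1. Poly_Mapping.lookup p 0"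
  by unfold_locales (simp_all add: lookup_add lookup_mult_0)

abbreviation const_mat :: "('v, 'k::field) mpoly mat \<Rightarrow> 'k mat" where
  "const_mat \<equiv> map_mat (\<lambda>p. Poly_Mapping.lookup p 0)"

text \<open>Taking constant terms is reduction modulo the maximal homogeneous ideal. It kills every
  \<open>d i\<close> of a minimal resolution, hence also the expression d h + h d for
  \<open>f\<close>.\<close>

lemma null_homotopic_const_0:
  assumes res: "minimal_graded_free_resolution P Q D e d"
    and f: "\<And>i. hom_mat (D i) (D i) (f i)" and comm: "\<And>i. d i * f (Suc i) = f i * d i"
    and aug: "\<And>w. w \<in> carrier_vec (length (D 0)) \<Longrightarrow> e \<bullet> (f 0 *\<^sub>v w) \<in> Q"
  shows "const_mat (f i) = 0\<^sub>m (length (D i)) (length (D i))"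
proof -
  have res': "graded_free_resolution P Q D e d"
    using res by (simp add: minimal_graded_free_resolution_def)
  obtain h where h: "\<And>i. hom_mat (D (Suc i)) (D i) (h i)" and h0: "d 0 * h 0 = f 0"
    and hS: "\<And>i. d (Suc i) * h (Suc i) = f (Suc i) - h i * d i"
    using null_homotopy[OF res' f comm aug] by blast
  note car = resolution_carrier[OF res'] and fc = hom_mat_carrier[OF f] and hc = hom_mat_carrier[OF h]
  have d: "const_mat (d i) = 0\<^sub>m (length (D i)) (length (D (Suc i)))" for i
    using res car[of i] by (intro eq_matI) (auto simp: minimal_graded_free_resolution_def)
  have dh: "const_mat (d i * h i) = 0\<^sub>m (length (D i)) (length (D i))" for i
    using const.mat_hom_mult[OF car hc, of i] d hc[of i] by simp
  show ?thesis
  proof (cases i)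
    case 0
    then show ?thesis using dh[of 0] h0 by simp
  next
    case (Suc j)
    let ?n = "length (D (Suc j))"
    have hd: "const_mat (h j * d j) = 0\<^sub>m ?n ?n"
      using const.mat_hom_mult[OF hc car, of j] d hc[of j] by simp
    show ?thesis
    proof (rule eq_matI)
      fix r c assume "r < dim_row (0\<^sub>m (length (D i)) (length (D i)) :: 'b mat)"
        "c < dim_col (0\<^sub>m (length (D i)) (length (D i)) :: 'b mat)"
      then have rc: "r < ?n" "c < ?n"
        using Suc by auto
      have "const_mat (h j * d j) $$ (r, c) = 0" "const_mat (d (Suc j) * h (Suc j)) $$ (r, c) = 0"
        using hd dh[of "Suc j"] rc by simp_all
      then show "const_mat (f i) $$ (r, c) = 0\<^sub>m (length (D i)) (length (D i)) $$ (r, c)"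
        using rc Suc fc[of "Suc j"] hc[of j] car[of j]
        by (simp add: hS lookup_minus del: index_mult_mat(1))
    qed (use fc[of i] in auto)
  qed
qed

text \<open>An identity matrix of size p cannot factor through a space of dimension q < p. Padding
  with zeros makes both factors square, so the product in the other order is also the identity; but
  its diagonal entry at q is zero.\<close>

lemma one_mat_factor_le:
  fixes A B :: "nat \<Rightarrow> nat \<Rightarrow> 'k::field"
  assumes *: "\<And>i j. i < p \<Longrightarrow> j < p \<Longrightarrow> (\<Sum>k<q. A i k * B k j) = (if i = j then 1 else 0)"
  shows "p \<le> q"
proof (rule ccontr)
  assume "\<not> p \<le> q"
  then have qp: "q < p" by simp
  define A' where "A' = mat p p (\<lambda>(i, k). if k < q then A i k else 0)"
  define B' where "B' = mat p p (\<lambda>(k, j). if k < q then B k j else 0)"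
  have "A' * B' = 1\<^sub>m p"
  proof (rule eq_matI)
    fix i j assume "i < dim_row (1\<^sub>m p :: 'k mat)" "j < dim_col (1\<^sub>m p :: 'k mat)"
    then have ij: "i < p" "j < p" by auto
    have "(A' * B') $$ (i, j) = (\<Sum>k<p. if k < q then A i k * B k j else 0)"
      using ij by (auto simp: A'_def B'_def scalar_prod_def atLeast0LessThan intro!: sum.cong)
    also have "\<dots> = (\<Sum>k<q. A i k * B k j)"
      using qp by (intro sum.mono_neutral_cong_right) auto
    finally show "(A' * B') $$ (i, j) = 1\<^sub>m p $$ (i, j)"
      using * ij by simp
  qed (auto simp: A'_def B'_def)
  then have "B' * A' = 1\<^sub>m p"
    by (rule mat_mult_left_right_inverse[rotated 2]) (auto simp: A'_def B'_def)
  then have "(B' * A') $$ (q, q) = 1"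
    using qp by simp
  then show False
    using qp by (simp add: A'_def B'_def scalar_prod_def)
qed

lemma count_list_conv_filter:
  "count_list xs x = length (filter (\<lambda>c. xs ! c = x) [0..<length xs])"
proof -
  have "count_list xs x = length (filter (\<lambda>y. y = x) xs)"
    by (induction xs) auto
  also have "\<dots> = length (filter (\<lambda>y. y = x) (map ((!) xs) [0..<length xs]))"
    by (simp add: map_nth)
  also have "\<dots> = length (filter (\<lambda>c. xs ! c = x) [0..<length xs])"
    by (simp add: filter_map comp_def)
  finally show ?thesis .
qed

text \<open>An entry between different degrees has no constant term. On the generators of degree
  \<alpha> the identity therefore factors through generators of the same degree, and only a rank
  comparison is left.\<close>

lemma count_list_le_of_const_inverse:
  assumes \<phi>: "hom_mat R C \<phi>" and \<psi>: "hom_mat C R \<psi>"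
    and inv: "const_mat \<psi> * const_mat \<phi> = 1\<^sub>m (length C)"
  shows "count_list C \<alpha> \<le> count_list R \<alpha>"
proof -
  define cs where "cs = filter (\<lambda>c. C ! c = \<alpha>) [0..<length C]"
  define rs where "rs = filter (\<lambda>r. R ! r = \<alpha>) [0..<length R]"
  have cs: "cs ! i < length C \<and> C ! (cs ! i) = \<alpha>" if "i < length cs" for i
    using nth_mem[OF that] by (auto simp: cs_def)
  have ds: "distinct cs" "distinct rs"
    by (simp_all add: cs_def rs_def)
  have "length cs \<le> length rs"
  proof (rule one_mat_factor_le)
    fix i j assume ij: "i < length cs" "j < length cs"
    let ?F = "\<lambda>r. const_mat \<psi> $$ (cs ! i, r) * const_mat \<phi> $$ (r, cs ! j)"
    note c = hom_mat_carrier[OF \<phi>] hom_mat_carrier[OF \<psi>]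
    have z: "?F r = 0" if "r < length R" "R ! r \<noteq> \<alpha>" for r
    proof -
      have "homogeneous (\<alpha> - R ! r) (\<phi> $$ (r, cs ! j))"
        using \<phi> cs[OF ij(2)] that by (auto simp: hom_mat_def)
      then have "Poly_Mapping.lookup (\<phi> $$ (r, cs ! j)) 0 = 0"
        using homogeneous_lookup_0 that by fastforce
      then show ?thesis
        using c cs[OF ij(2)] that by simp
    qed
    have "(\<Sum>k<length rs. ?F (rs ! k)) = sum ?F (set rs)"
      using sum.reindex_bij_betw[OF bij_betw_nth[OF ds(2) refl refl]] by simp
    also have "\<dots> = sum ?F {..<length R}"
      by (rule sum.mono_neutral_left) (use z in \<open>auto simp: rs_def\<close>)
    also have "\<dots> = (const_mat \<psi> * const_mat \<phi>) $$ (cs ! i, cs ! j)"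
      using c cs[OF ij(1)] cs[OF ij(2)] by (auto simp: scalar_prod_def atLeast0LessThan intro!: sum.cong)
    also have "\<dots> = (if i = j then 1 else 0)"
      unfolding inv using cs[OF ij(1)] cs[OF ij(2)] ij ds(1) by (simp add: nth_eq_iff_index_eq)
    finally show "(\<Sum>k<length rs. ?F (rs ! k)) = (if i = j then 1 else 0)" .
  qed
  then show ?thesis
    by (simp add: count_list_conv_filter cs_def rs_def)
qed

text \<open>A minimal resolution has the fewest summands in each degree: on \<open>D\<close> the map
  \<psi> \<phi> minus the identity is null-homotopic, so the constant parts of \<psi> and \<phi>
  compose to the identity there.\<close>

lemma minimal_resolution_count_le:
  assumes Q: "graded_ideal Q"
    and res: "minimal_graded_free_resolution P Q D e d" and res': "graded_free_resolution P Q D' e' d'"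
  shows "count_list (D i) \<alpha> \<le> count_list (D' i) \<alpha>"
proof -
  have res1: "graded_free_resolution P Q D e d"
    using res by (simp add: minimal_graded_free_resolution_def)
  obtain \<phi> where \<phi>: "\<And>i. hom_mat (D' i) (D i) (\<phi> i)" and \<phi>d: "\<And>i. d' i * \<phi> (Suc i) = \<phi> i * d i"
    and \<phi>e: "\<And>w. w \<in> carrier_vec (length (D 0)) \<Longrightarrow> e' \<bullet> (\<phi> 0 *\<^sub>v w) - e \<bullet> w \<in> Q"
    using comparison_map[OF Q res1 res'] by blast
  obtain \<psi> where \<psi>: "\<And>i. hom_mat (D i) (D' i) (\<psi> i)" and \<psi>d: "\<And>i. d i * \<psi> (Suc i) = \<psi> i * d' i"
    and \<psi>e: "\<And>w. w \<in> carrier_vec (length (D' 0)) \<Longrightarrow> e \<bullet> (\<psi> 0 *\<^sub>v w) - e' \<bullet> w \<in> Q"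
    using comparison_map[OF Q res' res1] by blast
  note \<phi>c = hom_mat_carrier[OF \<phi>] and \<psi>c = hom_mat_carrier[OF \<psi>]
    and car = resolution_carrier[OF res1] and car' = resolution_carrier[OF res']
  define f where "f i = \<psi> i * \<phi> i - 1\<^sub>m (length (D i))" for i
  have f: "hom_mat (D i) (D i) (f i)" for i
    unfolding f_def by (intro hom_mat_diff hom_mat_mult[OF \<psi> \<phi>] hom_mat_one)
  have comm: "d i * f (Suc i) = f i * d i" for i
  proof -
    have "d i * f (Suc i) = d i * (\<psi> (Suc i) * \<phi> (Suc i)) - d i * 1\<^sub>m (length (D (Suc i)))"
      unfolding f_def by (rule mult_minus_distrib_mat[OF car mult_carrier_mat[OF \<psi>c \<phi>c] one_carrier_mat])
    also have "d i * (\<psi> (Suc i) * \<phi> (Suc i)) = \<psi> i * d' i * \<phi> (Suc i)"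
      using assoc_mult_mat[OF car \<psi>c \<phi>c] \<psi>d by simp
    also have "\<dots> = \<psi> i * \<phi> i * d i"
      using assoc_mult_mat[OF \<psi>c car' \<phi>c] assoc_mult_mat[OF \<psi>c \<phi>c car] \<phi>d by simp
    also have "d i * 1\<^sub>m (length (D (Suc i))) = 1\<^sub>m (length (D i)) * d i"
      using car[of i] by simp
    also have "\<psi> i * \<phi> i * d i - 1\<^sub>m (length (D i)) * d i = f i * d i"
      unfolding f_def
      by (rule minus_mult_distrib_mat[OF mult_carrier_mat[OF \<psi>c \<phi>c] one_carrier_mat car, symmetric])
    finally show ?thesis .
  qed
  have aug: "e \<bullet> (f 0 *\<^sub>v w) \<in> Q" if w: "w \<in> carrier_vec (length (D 0))" for w
  proof -
    have w': "\<phi> 0 *\<^sub>v w \<in> carrier_vec (length (D' 0))"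
      using \<phi>c[of 0] w by auto
    have "f 0 *\<^sub>v w = \<psi> 0 *\<^sub>v (\<phi> 0 *\<^sub>v w) - w"
      unfolding f_def using \<phi>c[of 0] \<psi>c[of 0] w assoc_mult_mat_vec[OF \<psi>c \<phi>c w]
      by (subst minus_mult_distrib_mat_vec) auto
    then have "e \<bullet> (f 0 *\<^sub>v w) = e \<bullet> (\<psi> 0 *\<^sub>v (\<phi> 0 *\<^sub>v w)) - e \<bullet> w"
      by (simp only: scalar_prod_minus_distrib[OF resolution_vec(1)[OF res1] mult_mat_vec_carrier[OF \<psi>c w'] w])
    also have "\<dots> = (e \<bullet> (\<psi> 0 *\<^sub>v (\<phi> 0 *\<^sub>v w)) - e' \<bullet> (\<phi> 0 *\<^sub>v w)) + (e' \<bullet> (\<phi> 0 *\<^sub>v w) - e \<bullet> w)"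
      by simp
    also have "\<dots> \<in> Q"
      using Q by (simp only: graded_ideal_def) (use \<phi>e[OF w] \<psi>e[OF w'] in blast)
    finally show ?thesis .
  qed
  have c0: "const_mat (f i) = 0\<^sub>m (length (D i)) (length (D i))"
    by (rule null_homotopic_const_0[OF res f comm aug])
  have "const_mat \<psi>i * const_mat \<phi>i = 1\<^sub>m (length (D i))" if "\<psi>i = \<psi> i" "\<phi>i = \<phi> i" for \<psi>i \<phi>i
  proof (rule eq_matI)
    fix r c assume "r < dim_row (1\<^sub>m (length (D i)) :: 'b mat)" "c < dim_col (1\<^sub>m (length (D i)) :: 'b mat)"
    then have rc: "r < length (D i)" "c < length (D i)" by auto
    have "const_mat (\<psi> i) * const_mat (\<phi> i) = const_mat (\<psi> i * \<phi> i)"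
      using const.mat_hom_mult[OF \<psi>c \<phi>c] by simp
    moreover have "const_mat (f i) $$ (r, c) = 0"
      using c0 rc by simp
    ultimately show "(const_mat \<psi>i * const_mat \<phi>i) $$ (r, c) = 1\<^sub>m (length (D i)) $$ (r, c)"
      using rc \<phi>c[of i] \<psi>c[of i] that
      by (auto simp: f_def lookup_minus split: if_splits)
  qed (use that \<phi>c[of i] \<psi>c[of i] in auto)
  then show ?thesis
    using count_list_le_of_const_inverse[OF \<phi> \<psi>] by blast
qed

text \<open>The preceding inequality, applied in both directions, gives the uniqueness that the
  definite description in \<open>betti\<close> requires.\<close>

lemma betti_eq_count:
  assumes "graded_ideal Q" "minimal_graded_free_resolution P Q D e d"
  shows "betti P Q i \<alpha> = count_list (D i) \<alpha>"
proof -
  have eq: "count_list (D' i) \<alpha> = count_list (D i) \<alpha>"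
    if "minimal_graded_free_resolution P Q D' e' d'" for D' e' d'
  proof (rule antisym)
    have "graded_free_resolution P Q D e d" "graded_free_resolution P Q D' e' d'"
      using assms(2) that by (simp_all only: minimal_graded_free_resolution_def)
    then show "count_list (D' i) \<alpha> \<le> count_list (D i) \<alpha>" "count_list (D i) \<alpha> \<le> count_list (D' i) \<alpha>"
      using minimal_resolution_count_le[OF assms(1)] that assms(2) by blast+
  qed
  show ?thesis
    unfolding betti_def
  proof (rule the_equality)
    show "\<exists>D' e d. minimal_graded_free_resolution P Q D' e d \<and> count_list (D i) \<alpha> = count_list (D' i) \<alpha>"
      using assms(2) by (intro exI conjI) (assumption, rule refl)
  next
    fix n assume "\<exists>D e d. minimal_graded_free_resolution P Q D e d \<and> n = count_list (D i) \<alpha>"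
    then show "n = count_list (D i) \<alpha>"
      by (elim exE conjE) (simp only: eq)
  qed
qed

section \<open>Pruning in row-major order\<close>

definition toggle :: "'a \<Rightarrow> 'a set \<Rightarrow> 'a set" where
  "toggle p S = (if p \<in> S then S - {p} else insert p S)"

text \<open>Step j pairs every face with the one that differs from it only in j. The fate of a face
  thus depends on a single partner, which must have the same lcm and still be available.\<close>

lemma pruned_edges_Suc_iff:
  assumes "\<sigma> \<subseteq> {..<length ms}" "j < length ms"
  shows "\<sigma> \<in> \<Union>(pruned_edges ms (Suc j)) \<longleftrightarrow> \<sigma> \<in> \<Union>(pruned_edges ms j) \<or>
    (face_lcm ms (toggle j \<sigma>) = face_lcm ms \<sigma> \<and> toggle j \<sigma> \<notin> \<Union>(pruned_edges ms j))"
proof -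
  define U where "U = \<Union>(pruned_edges ms j)"
  let ?ok = "\<lambda>\<tau>. \<tau> \<subseteq> {..<length ms} \<and> j \<notin> \<tau> \<and> face_lcm ms \<tau> = face_lcm ms (insert j \<tau>) \<and>
        \<tau> \<notin> U \<and> insert j \<tau> \<notin> U"
  have "\<sigma> \<in> \<Union>(pruned_edges ms (Suc j)) \<longleftrightarrow>
      \<sigma> \<in> U \<or> (\<exists>\<tau>. ?ok \<tau> \<and> (\<sigma> = \<tau> \<or> \<sigma> = insert j \<tau>))"
    unfolding pruned_edges.simps Union_Un_distrib Un_iff U_def[symmetric] by (rule disj_cong) blast+
  also have "(\<exists>\<tau>. ?ok \<tau> \<and> (\<sigma> = \<tau> \<or> \<sigma> = insert j \<tau>)) \<longleftrightarrow> ?ok \<sigma> \<or> (j \<in> \<sigma> \<and> ?ok (\<sigma> - {j}))"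
  proof
    assume "\<exists>\<tau>. ?ok \<tau> \<and> (\<sigma> = \<tau> \<or> \<sigma> = insert j \<tau>)"
    then obtain \<tau> where \<tau>: "?ok \<tau>" "\<sigma> = \<tau> \<or> \<sigma> = insert j \<tau>"
      by blast
    moreover from \<tau>(1) have "insert j \<tau> - {j} = \<tau>"
      by simp
    ultimately show "?ok \<sigma> \<or> (j \<in> \<sigma> \<and> ?ok (\<sigma> - {j}))"
      by (metis insertI1)
  next
    assume "?ok \<sigma> \<or> (j \<in> \<sigma> \<and> ?ok (\<sigma> - {j}))"
    then show "\<exists>\<tau>. ?ok \<tau> \<and> (\<sigma> = \<tau> \<or> \<sigma> = insert j \<tau>)"
      by (metis insert_Diff)
  qed
  also have "\<sigma> \<in> U \<or> \<dots> \<longleftrightarrow> \<sigma> \<in> U \<or> (face_lcm ms (toggle j \<sigma>) = face_lcm ms \<sigma> \<and> toggle j \<sigma> \<notin> U)"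
    using assms by (auto simp: toggle_def insert_absorb)
  finally show ?thesis
    unfolding U_def .
qed

text \<open>The nonempty faces surviving the steps before position \<open>(r, c)\<close> in row-major order. A face is
  a set \<open>S\<close> of positions; \<open>A\<close> and \<open>B\<close> are its rows and columns, \<open>b\<close> is the first column and
  \<open>M\<close> the last row.\<close>

definition survives ::
  "nat set \<Rightarrow> nat set \<Rightarrow> nat \<Rightarrow> nat \<Rightarrow> nat \<Rightarrow> nat \<Rightarrow> (nat \<times> nat) set \<Rightarrow> bool" where
  "survives A B b M r c S \<longleftrightarrow>
     (\<forall>a y. (a, y) \<in> S \<and> a < r \<and> a < M \<longrightarrow> y = b) \<and>
     (\<forall>y \<in> B. \<exists>a \<ge> min r M. (a, y) \<in> S) \<and>
     (r < M \<and> r \<in> A \<and> b < c \<longrightarrow>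
        (\<forall>y. (r, y) \<in> S \<longleftrightarrow> y = b) \<and> (\<exists>a > r. (a, b) \<in> S) \<or>
        (\<forall>y \<in> B. y < c \<longrightarrow> (r, y) \<in> S \<and> (\<forall>a > r. (a, y) \<notin> S)))"

text \<open>With step (r, c) about to be carried out, the clauses of \<open>survives\<close> mean
  the following. Finished rows above M contain only the first column. Every column is met by an
  unfinished row, where M always counts as unfinished. In the current row, once column b has been
  treated, either the row is {b} and b is met again below, or this row is the last one to meet each
  treated column. A, B, b, M are parameters so that they can be shared by a face and its
  partner.\<close>

locale position_face =
  fixes A B :: "nat set" and b M :: nat and S :: "(nat \<times> nat) set"
  assumes rows: "fst ` S = A" and cols: "snd ` S = B"
    and b: "b \<in> B" "\<And>y. y \<in> B \<Longrightarrow> b \<le> y"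
    and M: "M \<in> A" "\<And>a. a \<in> A \<Longrightarrow> a \<le> M"
begin

lemma memD: "(a, y) \<in> S \<Longrightarrow> a \<in> A \<and> y \<in> B"
  using rows cols by force

lemma ex_col: "a \<in> A \<Longrightarrow> \<exists>y. (a, y) \<in> S"
  using rows by force

lemma ex_row: "y \<in> B \<Longrightarrow> \<exists>a. (a, y) \<in> S"
  using cols by force

lemma survives_start: "survives A B b M 0 0 S"
  using ex_row by (auto simp: survives_def)

text \<open>At the end of a row r < M of the face the second alternative is impossible, since row M
  would then meet no column. So the row is {b}, and all columns are met strictly below it. Rows
  outside A or from M on change nothing.\<close>

lemma survives_next_row:
  assumes "B \<subseteq> {..<m}"
  shows "survives A B b M r m S \<longleftrightarrow> survives A B b M (Suc r) 0 S"
proof (cases "r < M \<and> r \<in> A")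
  case True
  have bm: "b < m"
    using assms b by auto
  show ?thesis
  proof
    assume s: "survives A B b M r m S"
    have "\<not> (\<forall>y \<in> B. y < m \<longrightarrow> (r, y) \<in> S \<and> (\<forall>a > r. (a, y) \<notin> S))"
      using True ex_col[OF M(1)] assms memD by (metis lessThan_iff subsetD)
    then have row: "\<And>y. (r, y) \<in> S \<longleftrightarrow> y = b" and b': "\<exists>a > r. (a, b) \<in> S"
      using s True bm unfolding survives_def by blast+
    have "\<exists>a \<ge> min (Suc r) M. (a, y) \<in> S" if y: "y \<in> B" for y
    proof (cases "y = b")
      case True
      then show ?thesis using b' by (auto intro: min.coboundedI1 Suc_leI)
    next
      case False
      obtain a where "a \<ge> min r M" "(a, y) \<in> S"
        using s y unfolding survives_def by blast
      moreover have "a \<noteq> r"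
        using calculation False row by auto
      ultimately show ?thesis
        using True by (intro exI[of _ a]) auto
    qed
    with s row show "survives A B b M (Suc r) 0 S"
      unfolding survives_def by (auto simp: less_Suc_eq)
  next
    assume s: "survives A B b M (Suc r) 0 S"
    have row: "(r, y) \<in> S \<longleftrightarrow> y = b" for y
      using s True ex_col[of r] unfolding survives_def by (metis lessI)
    moreover have "\<exists>a > r. (a, b) \<in> S"
      using s True b unfolding survives_def by (auto simp: Suc_le_eq)
    moreover have "\<exists>a \<ge> min r M. (a, y) \<in> S" if "y \<in> B" for y
    proof -
      obtain a where "a \<ge> min (Suc r) M" "(a, y) \<in> S"
        using s \<open>y \<in> B\<close> unfolding survives_def by blast
      then show ?thesis
        by (intro exI[of _ a]) auto
    qed
    ultimately show "survives A B b M r m S"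
      using s unfolding survives_def by (auto simp: less_Suc_eq)
  qed
next
  case False
  have "a \<ge> min (Suc r) M \<longleftrightarrow> a \<ge> min r M" if "a \<in> A" for a
    using False that M by (auto simp: min_def not_less) (metis le_SucE le_antisym not_less_eq_eq)+
  then have "(\<exists>a \<ge> min (Suc r) M. (a, y) \<in> S) \<longleftrightarrow> (\<exists>a \<ge> min r M. (a, y) \<in> S)" for y
    using memD by blast
  moreover have "(a < Suc r \<and> a < M) \<longleftrightarrow> (a < r \<and> a < M)" if "a \<in> A" for a
    using False that by (auto simp: less_Suc_eq)
  ultimately show ?thesis
    using False memD unfolding survives_def by (smt (verit) not_less_zero)
qed

text \<open>Adding a position of A x B never changes rows and columns, and removing one does not
  when its row and its column each contain another position. It remains to decide when the toggled
  face also satisfies the clauses, which depends on whether the row is the last one and whether c is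
  its first column.\<close>

lemma survives_next_col:
  "survives A B b M r (Suc c) S \<longleftrightarrow> survives A B b M r c S \<and>
    \<not> ((fst ` toggle (r, c) S = A \<and> snd ` toggle (r, c) S = B) \<and>
       survives A B b M r c (toggle (r, c) S))"
    (is "?new \<longleftrightarrow> ?old \<and> \<not> (?cov \<and> ?tog)")
proof -
  \<comment> \<open>Outside A x B the position is absent, and adding it creates a new row or
    column.\<close>
  have fewer: "\<not> ?cov" if "r \<notin> A \<or> c \<notin> B"
  proof -
    have "(r, c) \<notin> S"
      using that memD by blast
    then have "fst ` toggle (r, c) S = insert r A" "snd ` toggle (r, c) S = insert c B"
      by (simp_all add: toggle_def rows cols)
    then show ?thesis
      using that by blast
  qed
  have cov_insert: "?cov" if "(r, c) \<notin> S" "r \<in> A" "c \<in> B"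
    using that by (simp add: toggle_def rows cols insert_absorb)
  have cov_remove: "?cov" if "(r, c) \<in> S" "(r, y) \<in> S" "y \<noteq> c" "(a, c) \<in> S" "a \<noteq> r" for a y
  proof -
    have "toggle (r, c) S = S - {(r, c)}"
      using that by (simp add: toggle_def)
    moreover have "fst ` (S - {(r, c)}) = fst ` S" "snd ` (S - {(r, c)}) = snd ` S"
    proof -
      have ins: "S = insert (r, c) (S - {(r, c)})"
        using that by blast
      have "(r, y) \<in> S - {(r, c)}" "(a, c) \<in> S - {(r, c)}"
        using that by auto
      then have "r \<in> fst ` (S - {(r, c)})" "c \<in> snd ` (S - {(r, c)})"
        by force+
      then show "fst ` (S - {(r, c)}) = fst ` S" "snd ` (S - {(r, c)}) = snd ` S"
        by (subst (2) ins, simp only: image_insert fst_conv snd_conv insert_absorb)+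
    qed
    ultimately show ?thesis
      using rows cols by simp
  qed
  consider "r \<notin> A \<or> c \<notin> B" | "r \<in> A" "c \<in> B" "r \<ge> M" | "r \<in> A" "r < M" "c = b"
    | "r \<in> A" "r < M" "c \<in> B" "b < c"
    using b(2) by force
  then show ?thesis
  proof cases
    case 1
    have "?new \<longleftrightarrow> ?old"
    proof (cases "r \<in> A")
      case True
      then have "c \<notin> B"
        using 1 by simp
      then have "b < Suc c \<longleftrightarrow> b < c"
        "(\<forall>y \<in> B. y < Suc c \<longrightarrow> P y) \<longleftrightarrow> (\<forall>y \<in> B. y < c \<longrightarrow> P y)" for P
        using b by (metis less_Suc_eq)+
      then show ?thesis
        by (simp only: survives_def)
    qed (simp add: survives_def)
    then show ?thesis
      using fewer[OF 1] by blast
  next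
    case 2
    then have r: "r = M"
      using M by force
    then have "?new \<longleftrightarrow> ?old"
      unfolding survives_def by simp
    \<comment> \<open>In the last row only (M, c) itself can meet column c from M on, so at most one
      of the two partners satisfies the second clause.\<close>
    moreover have "\<not> ?tog" if ?old
    proof
      assume ?tog
      then obtain a where "a \<ge> M" "(a, c) \<in> toggle (r, c) S"
        using 2 r unfolding survives_def by auto
      moreover obtain a' where "a' \<ge> M" "(a', c) \<in> S"
        using \<open>?old\<close> 2 r unfolding survives_def by auto
      ultimately show False
        using r M memD by (auto simp: toggle_def split: if_splits) (metis le_antisym)+
    qed
    ultimately show ?thesis by blast
  next
    case 3
    let ?P = "\<lambda>S. (\<forall>a y. (a, y) \<in> S \<and> a < r \<longrightarrow> y = b) \<and> (\<forall>y \<in> B. \<exists>a \<ge> r. (a, y) \<in> S)"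
    let ?I = "\<forall>y. (r, y) \<in> S \<longleftrightarrow> y = b"
    have aM: "a < r \<and> a < M \<longleftrightarrow> a < r" "min r M = r" for a
      using 3 by auto
    have old: "survives A B b M r c S' \<longleftrightarrow> ?P S'" for S'
      using 3 by (simp add: survives_def aM)
    have "(\<forall>y \<in> B. y < Suc c \<longrightarrow> Q y) \<longleftrightarrow> Q b" for Q
      using 3 b by (metis le_less_Suc_eq le_antisym lessI less_Suc_eq_le)
    \<comment> \<open>For c = b the second alternative concerns column b alone. Survivors contain
      (r, b), since adding it is always allowed; it cannot be removed precisely when it is the whole
      row or when column b is not met below.\<close>
    then have new: "?new \<longleftrightarrow> ?P S \<and>
        (?I \<and> (\<exists>a > r. (a, b) \<in> S) \<or> (r, b) \<in> S \<and> (\<forall>a > r. (a, b) \<notin> S))"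
      using 3 by (simp add: survives_def aM)
    show ?thesis
    proof
      assume n: ?new
      then have "(r, b) \<in> S"
        unfolding new by blast
      then have tog: "toggle (r, c) S = S - {(r, b)}"
        using 3 by (simp add: toggle_def)
      have "\<not> (?cov \<and> ?tog)"
      proof
        assume ct: "?cov \<and> ?tog"
        then have "r \<in> fst ` (S - {(r, b)})"
          using tog 3 by simp
        then obtain y where "(r, y) \<in> S" "y \<noteq> b"
          by fastforce
        then have none: "\<forall>a > r. (a, b) \<notin> S"
          using n unfolding new by blast
        have "?P (S - {(r, b)})"
          using ct unfolding old tog by blast
        then obtain a where "a \<ge> r" "(a, b) \<in> S - {(r, b)}"
          using b(1) by blast
        with none show False
          by (cases "a = r") auto
      qed
      with n show "?old \<and> \<not> (?cov \<and> ?tog)"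
        unfolding old new by blast
    next
      assume *: "?old \<and> \<not> (?cov \<and> ?tog)"
      then have P: "?P S"
        unfolding old by blast
      have rb: "(r, b) \<in> S"
      proof (rule ccontr)
        assume "(r, b) \<notin> S"
        then have tog: "toggle (r, c) S = insert (r, b) S" and ?cov
          using 3 b(1) cov_insert by (simp_all add: toggle_def)
        moreover have "?P (insert (r, b) S)"
          using P by blast
        ultimately show False
          using * unfolding old by simp
      qed
      then have tog: "toggle (r, c) S = S - {(r, b)}"
        using 3 by (simp add: toggle_def)
      have "?I" if a: "a > r" "(a, b) \<in> S" for a
      proof (rule ccontr)
        assume "\<not> ?I"
        then obtain y where y: "(r, y) \<in> S" "y \<noteq> b"
          using rb by blast
        have "\<exists>a \<ge> r. (a, y') \<in> S - {(r, b)}" if "y' \<in> B" for y'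
        proof (cases "y' = b")
          case True
          then show ?thesis
            using a by (intro exI[of _ a]) auto
        next
          case False
          then show ?thesis
            using P that by blast
        qed
        then have "?P (S - {(r, b)})"
          using P by blast
        then have ?tog
          unfolding old tog .
        moreover have ?cov
          using cov_remove[of y a] rb a y 3 by simp
        ultimately show False
          using * by blast
      qed
      then show ?new
        unfolding new using P rb by blast
    qed
  next
    case 4
    let ?I = "\<lambda>S. (\<forall>y. (r, y) \<in> S \<longleftrightarrow> y = b) \<and> (\<exists>a > r. (a, b) \<in> S)"
    let ?J = "\<lambda>c S. \<forall>y \<in> B. y < c \<longrightarrow> (r, y) \<in> S \<and> (\<forall>a > r. (a, y) \<notin> S)"
    have aM: "a < r \<and> a < M \<longleftrightarrow> a < r" "min r M = r" for a
      using 4 by auto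
    have iff: "survives A B b M r c' S' \<longleftrightarrow>
        (\<forall>a y. (a, y) \<in> S' \<and> a < r \<longrightarrow> y = b) \<and> (\<forall>y \<in> B. \<exists>a \<ge> r. (a, y) \<in> S') \<and> (?I S' \<or> ?J c' S')"
      if "b < c'" for S' c'
      using 4 that by (simp add: survives_def aM)
    have J_Suc: "?J (Suc c) S \<longleftrightarrow> ?J c S \<and> (r, c) \<in> S \<and> (\<forall>a > r. (a, c) \<notin> S)"
      using 4 by (auto simp: less_Suc_eq)
    note iff_c = iff[OF 4(4)] and iff_Suc = iff[OF less_SucI[OF 4(4)]]
    show ?thesis
    proof
      assume new: ?new
      then have ?old
        unfolding iff_c iff_Suc J_Suc by blast
      moreover have "\<not> ?tog"
      proof
        assume tog: ?tog
        \<comment> \<open>Adding (r, c) to a row equal to {b} destroys the first alternative, and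
          the second fails because b is met below. If instead (r, c) is the last position of its
          column, removing it leaves the column unmet from r on.\<close>
        from new consider "?I S" | "?J (Suc c) S"
          unfolding iff_Suc by blast
        then show False
        proof cases
          case 1
          then have "(r, c) \<notin> S"
            using 4(4) by (metis less_irrefl)
          then have "toggle (r, c) S = insert (r, c) S"
            by (simp add: toggle_def)
          moreover have "\<not> ?I (insert (r, c) S)"
            using 4(4) by (metis insertI1 less_irrefl)
          moreover have "\<not> ?J c (insert (r, c) S)"
            using 1 4(4) b(1) by (meson insertI2)
          ultimately show False
            using tog unfolding iff_c by presburger
        next
          case 2
          then have rc: "(r, c) \<in> S" and none: "\<forall>a > r. (a, c) \<notin> S"
            unfolding J_Suc by blast+
          obtain a where "a \<ge> r" "(a, c) \<in> toggle (r, c) S"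
            using tog 4(3) unfolding iff_c by blast
          with rc none show False
            by (cases "a = r") (auto simp: toggle_def)
        qed
      qed
      ultimately show "?old \<and> \<not> (?cov \<and> ?tog)" by blast
    next
      assume *: "?old \<and> \<not> (?cov \<and> ?tog)"
      show ?new
      proof (cases "?I S")
        case True
        then show ?thesis
          using * unfolding iff_c iff_Suc by blast
      next
        case False
        \<comment> \<open>Toggling (r, c) does not touch the columns already treated, and (r, b)
          keeps the row nonempty. So survival forces (r, c) to be present and column c to be absent
          below.\<close>
        then have J: "?J c S"
          using * unfolding iff_c by blast
        have "(r, c) \<in> S"
        proof (rule ccontr)
          assume rc: "(r, c) \<notin> S"
          then have "toggle (r, c) S = insert (r, c) S"
            by (simp add: toggle_def)
          moreover have "?J c (insert (r, c) S)"
            using J by auto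
          ultimately have ?tog
            using * unfolding iff_c by (simp only:) blast
          then show False
            using * cov_insert[OF rc] 4 by blast
        qed
        moreover have "(a, c) \<notin> S" if "a > r" for a
        proof
          assume ac: "(a, c) \<in> S"
          have tog: "toggle (r, c) S = S - {(r, c)}"
            using calculation by (simp add: toggle_def)
          have "\<exists>a \<ge> r. (a, y) \<in> S - {(r, c)}" if y: "y \<in> B" for y
          proof (cases "y = c")
            case True
            have "(a, c) \<in> S - {(r, c)}"
              using ac \<open>a > r\<close> by simp
            then show ?thesis
              unfolding True using \<open>a > r\<close> less_imp_le by blast
          next
            case False
            obtain a' where "a' \<ge> r" "(a', y) \<in> S"
              using * y unfolding iff_c by blast
            with False show ?thesis
              by (intro exI[of _ a']) simp
          qed
          moreover have "?J c (S - {(r, c)})"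
            using J by simp
          moreover have "\<forall>a y. (a, y) \<in> S - {(r, c)} \<and> a < r \<longrightarrow> y = b"
            using * unfolding iff_c by blast
          ultimately have ?tog
            unfolding iff_c tog by blast
          moreover have ?cov
            using cov_remove[of b a] \<open>(r, c) \<in> S\<close> J 4 b(1) ac \<open>a > r\<close> by blast
          ultimately show False
            using * by blast
        qed
        ultimately show ?thesis
          using * J unfolding iff_c iff_Suc J_Suc by blast
      qed
    qed
  qed
qed

text \<open>After all rows, every row of A before M is {b}, and each column must be met in row M
  because nothing lies beyond it.\<close>

lemma survives_end:
  assumes "A \<subseteq> {..<n}"
  shows "survives A B b M n 0 S \<longleftrightarrow> S = A \<times> {b} \<union> {M} \<times> B"
proof -
  have Mn: "M < n"
    using assms M by auto
  show ?thesis
  proof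
    assume s: "survives A B b M n 0 S"
    have eq: "y = b" if "(a, y) \<in> S" "a \<noteq> M" for a y
      using s that M(2) memD[OF that(1)] Mn unfolding survives_def
      by (metis le_neq_implies_less order.strict_trans)
    have "(M, y) \<in> S" if y: "y \<in> B" for y
    proof -
      obtain a where "a \<ge> M" "(a, y) \<in> S"
        using s y Mn unfolding survives_def by auto
      then show ?thesis
        using M(2) memD by (metis le_antisym)
    qed
    then show "S = A \<times> {b} \<union> {M} \<times> B"
      using eq memD ex_col b(1) by (auto; metis)
  next
    assume S: "S = A \<times> {b} \<union> {M} \<times> B"
    have 2: "\<forall>y \<in> B. \<exists>a \<ge> min n M. (a, y) \<in> S"
    proof
      fix y assume "y \<in> B"
      then have "(M, y) \<in> S"
        using S by blast
      then show "\<exists>a \<ge> min n M. (a, y) \<in> S"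
        by (meson min.cobounded2)
    qed
    have "\<forall>a y. (a, y) \<in> S \<and> a < n \<and> a < M \<longrightarrow> y = b"
      using S by blast
    with 2 Mn show "survives A B b M n 0 S"
      by (simp add: survives_def)
  qed
qed

end

section \<open>The row-major list of generators and its critical faces\<close>

definition set_exp :: "'v set \<Rightarrow> 'v \<Rightarrow> nat" where
  "set_exp C v = of_bool (v \<in> C)"

lemma set_exp_inject [simp]: "set_exp C = set_exp C' \<longleftrightarrow> C = C'"
  by (auto simp: set_exp_def fun_eq_iff)

lemma set_exp_empty [simp]: "set_exp {} = 0"
  by (auto simp: set_exp_def fun_eq_iff)

lemma set_exp_le_iff: "set_exp C \<le> a \<longleftrightarrow> (\<forall>v \<in> C. a v \<noteq> 0)"
  by (auto simp: set_exp_def le_fun_def Suc_le_eq)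

lemma set_exp_eq_0_iff [simp]: "set_exp C = 0 \<longleftrightarrow> C = {}"
  by (auto simp: set_exp_def fun_eq_iff)

lemma set_exp_insert: "v \<notin> B \<Longrightarrow> set_exp (insert v B) = set_exp {v} + set_exp B"
  by (auto simp: set_exp_def fun_eq_iff)

definition position :: "nat \<Rightarrow> nat \<Rightarrow> nat \<times> nat" where
  "position m j = (j div m, j mod m)"

lemma inj_position: "inj (position m)"
proof (rule injI)
  fix i j assume "position m i = position m j"
  then show "i = j"
    unfolding position_def by (metis div_mult_mod_eq prod.inject)
qed

lemma position_toggle: "position m ` toggle j \<sigma> = toggle (position m j) (position m ` \<sigma>)"
proof -
  have "position m ` (\<sigma> - {j}) = position m ` \<sigma> - {position m j}"
    by (simp add: image_set_diff[OF inj_position])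
  moreover have "position m j \<in> position m ` \<sigma> \<longleftrightarrow> j \<in> \<sigma>"
    by (rule inj_image_mem_iff[OF inj_position])
  ultimately show ?thesis
    by (simp add: toggle_def)
qed

text \<open>If one side is empty, so is the list; the empty face is then the only critical one,
  matching the zero ideal.\<close>

definition grid_gens :: "'v list \<Rightarrow> 'v list \<Rightarrow> ('v \<Rightarrow> nat) list" where
  "grid_gens xs ys = map (\<lambda>j. set_exp {xs ! (j div length ys), ys ! (j mod length ys)})
     [0..<length xs * length ys]"

locale vertex_lists =
  fixes xs ys :: "'v list"
  assumes distinct: "distinct xs" "distinct ys" and disjoint: "set xs \<inter> set ys = {}"
begin

abbreviation "n \<equiv> length xs"
abbreviation "m \<equiv> length ys"
abbreviation "gens \<equiv> grid_gens xs ys"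
abbreviation "cells \<sigma> \<equiv> position m ` \<sigma>"
abbreviation "row_set \<sigma> \<equiv> fst ` cells \<sigma>"
abbreviation "col_set \<sigma> \<equiv> snd ` cells \<sigma>"

definition vertices :: "nat set \<Rightarrow> 'v set" where
  "vertices \<sigma> = (!) xs ` row_set \<sigma> \<union> (!) ys ` col_set \<sigma>"

lemma length_gens [simp]: "length gens = n * m"
  by (simp add: grid_gens_def)

lemma rows_cols:
  assumes "\<sigma> \<subseteq> {..<n * m}"
  shows "row_set \<sigma> \<subseteq> {..<n}" "col_set \<sigma> \<subseteq> {..<m}" "finite (row_set \<sigma>)" "finite (col_set \<sigma>)"
proof -
  have fin: "finite \<sigma>"
    using assms by (rule finite_subset) simp
  have "j div m < n \<and> j mod m < m" if "j \<in> \<sigma>" for j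
  proof -
    have j: "j < n * m"
      using assms that by auto
    then have "0 < m"
      by (cases "m = 0") auto
    then show ?thesis
      using j by (simp add: less_mult_imp_div_less)
  qed
  then show "row_set \<sigma> \<subseteq> {..<n}" "col_set \<sigma> \<subseteq> {..<m}"
    by (auto simp: position_def)
  show "finite (row_set \<sigma>)" "finite (col_set \<sigma>)"
    using fin by simp_all
qed

lemma inj_nth: "inj_on ((!) xs) {..<n}" "inj_on ((!) ys) {..<m}"
  using distinct by (auto simp: inj_on_def nth_eq_iff_index_eq)

lemma vertices_inter:
  assumes "\<sigma> \<subseteq> {..<n * m}"
  shows "vertices \<sigma> \<inter> set xs = (!) xs ` row_set \<sigma>" "vertices \<sigma> \<inter> set ys = (!) ys ` col_set \<sigma>"
proof -
  have "(!) xs ` row_set \<sigma> \<subseteq> set xs" "(!) ys ` col_set \<sigma> \<subseteq> set ys"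
    using rows_cols[OF assms] by (meson image_subsetI lessThan_iff nth_mem subsetD)+
  then show "vertices \<sigma> \<inter> set xs = (!) xs ` row_set \<sigma>" "vertices \<sigma> \<inter> set ys = (!) ys ` col_set \<sigma>"
    unfolding vertices_def using disjoint by blast+
qed

text \<open>The two lists are disjoint, so intersecting with \<open>set xs\<close> and
  \<open>set ys\<close> recovers the rows and the columns.\<close>

lemma vertices_eq_iff:
  assumes "\<sigma> \<subseteq> {..<n * m}" "\<tau> \<subseteq> {..<n * m}"
  shows "vertices \<sigma> = vertices \<tau> \<longleftrightarrow> row_set \<sigma> = row_set \<tau> \<and> col_set \<sigma> = col_set \<tau>"
proof
  assume "vertices \<sigma> = vertices \<tau>"
  then have "(!) xs ` row_set \<sigma> = (!) xs ` row_set \<tau>" "(!) ys ` col_set \<sigma> = (!) ys ` col_set \<tau>"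
    using vertices_inter assms by metis+
  then show "row_set \<sigma> = row_set \<tau> \<and> col_set \<sigma> = col_set \<tau>"
    using inj_on_image_eq_iff[OF inj_nth(1)] inj_on_image_eq_iff[OF inj_nth(2)]
      rows_cols[OF assms(1)] rows_cols[OF assms(2)] by metis
qed (simp add: vertices_def)

lemma face_lcm_gens:
  assumes "\<sigma> \<subseteq> {..<n * m}"
  shows "face_lcm gens \<sigma> = set_exp (vertices \<sigma>)"
proof
  fix v
  have fin: "finite \<sigma>"
    using assms by (rule finite_subset) simp
  have val: "(gens ! j) v = of_bool (v = xs ! (j div m) \<or> v = ys ! (j mod m))" if "j \<in> \<sigma>" for j
  proof -
    have "j < n * m"
      using assms that by auto
    then show ?thesis
      by (simp add: grid_gens_def set_exp_def)
  qed
  have mem: "v \<in> vertices \<sigma> \<longleftrightarrow> (\<exists>j \<in> \<sigma>. v = xs ! (j div m) \<or> v = ys ! (j mod m))"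
    unfolding vertices_def position_def by (auto simp: image_image)
  show "face_lcm gens \<sigma> v = set_exp (vertices \<sigma>) v"
  proof (cases "v \<in> vertices \<sigma>")
    case True
    then obtain j where j: "j \<in> \<sigma>" "(gens ! j) v = 1"
      using mem val by auto
    have "Max (insert 0 ((\<lambda>i. (gens ! i) v) ` \<sigma>)) = 1"
    proof (rule Max_eqI)
      show "1 \<in> insert 0 ((\<lambda>i. (gens ! i) v) ` \<sigma>)"
        using j by (metis image_eqI insertI2)
      show "y \<le> 1" if "y \<in> insert 0 ((\<lambda>i. (gens ! i) v) ` \<sigma>)" for y
        using that val by auto
    qed (use fin in simp)
    then show ?thesis
      using True by (simp add: face_lcm_def set_exp_def)
  next
    case False
    then have "(gens ! j) v = 0" if "j \<in> \<sigma>" for j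
      using val[OF that] mem that by auto
    then have "insert 0 ((\<lambda>i. (gens ! i) v) ` \<sigma>) = {0}"
      by auto
    then have "face_lcm gens \<sigma> v = Max {0}"
      by (simp only: face_lcm_def)
    then show ?thesis
      using False by (simp add: set_exp_def)
  qed
qed

lemma face_lcm_eq_iff:
  assumes "\<sigma> \<subseteq> {..<n * m}" "\<tau> \<subseteq> {..<n * m}"
  shows "face_lcm gens \<sigma> = face_lcm gens \<tau> \<longleftrightarrow> row_set \<sigma> = row_set \<tau> \<and> col_set \<sigma> = col_set \<tau>"
  using assms by (simp add: face_lcm_gens vertices_eq_iff)

text \<open>The partner of the empty face is a single generator, whose lcm is not 1. The empty face
  is kept apart because \<open>Min\<close> and \<open>Max\<close> have no meaningful value on its
  row and column sets.\<close>

lemma empty_not_pruned: "j \<le> n * m \<Longrightarrow> {} \<notin> \<Union>(pruned_edges gens j)"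
proof (induction j)
  case (Suc j)
  then have "face_lcm gens (toggle j {}) \<noteq> face_lcm gens {}"
    by (subst face_lcm_eq_iff) (auto simp: toggle_def)
  then show ?case
    using Suc pruned_edges_Suc_iff[of "{}" gens j] by simp
qed simp

abbreviation "survives_to \<sigma> \<equiv> survives (row_set \<sigma>) (col_set \<sigma>) (Min (col_set \<sigma>)) (Max (row_set \<sigma>))"

lemma position_face:
  assumes "\<sigma> \<subseteq> {..<n * m}" "\<sigma> \<noteq> {}"
  shows "position_face (row_set \<sigma>) (col_set \<sigma>) (Min (col_set \<sigma>)) (Max (row_set \<sigma>)) (cells \<sigma>)"
  using rows_cols[OF assms(1)] assms(2) by unfold_locales (auto intro: Min_in Max_in)

text \<open>The induction covers all faces at once, because step j also needs the status of the
  partner. The parameters of \<open>survives\<close> can be taken from \<sigma> for both: a partner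
  with the same lcm has the same rows and columns.\<close>

lemma not_pruned_iff:
  assumes "j \<le> n * m" "\<sigma> \<subseteq> {..<n * m}" "\<sigma> \<noteq> {}"
  shows "\<sigma> \<notin> \<Union>(pruned_edges gens j) \<longleftrightarrow> survives_to \<sigma> (j div m) (j mod m) (cells \<sigma>)"
  using assms
proof (induction j arbitrary: \<sigma>)
  case 0
  interpret position_face "row_set \<sigma>" "col_set \<sigma>" "Min (col_set \<sigma>)" "Max (row_set \<sigma>)" "cells \<sigma>"
    using 0 by (intro position_face)
  show ?case
    using survives_start by simp
next
  case (Suc j)
  interpret position_face "row_set \<sigma>" "col_set \<sigma>" "Min (col_set \<sigma>)" "Max (row_set \<sigma>)" "cells \<sigma>"
    using Suc.prems by (intro position_face)
  let ?r = "j div m" and ?c = "j mod m" and ?\<tau> = "toggle j \<sigma>"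
  have j: "j < n * m"
    using Suc.prems by simp
  have m: "0 < m"
    using j by (cases "m = 0") auto
  have \<tau>: "?\<tau> \<subseteq> {..<n * m}"
    using Suc.prems j by (auto simp: toggle_def)
  have tog: "toggle (?r, ?c) (cells \<sigma>) = cells ?\<tau>"
    unfolding position_toggle by (simp add: position_def)
  have eq: "(face_lcm gens ?\<tau> = face_lcm gens \<sigma> \<and> ?\<tau> \<notin> \<Union>(pruned_edges gens j)) \<longleftrightarrow>
      ((row_set ?\<tau> = row_set \<sigma> \<and> col_set ?\<tau> = col_set \<sigma>) \<and> survives_to \<sigma> ?r ?c (cells ?\<tau>))"
  \<comment> \<open>The induction hypothesis speaks of nonempty faces; an empty partner has a
    different row set and so a different lcm.\<close>
  proof (cases "?\<tau> = {}")
    case True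
    then have "row_set ?\<tau> \<noteq> row_set \<sigma>"
      using Suc.prems(3) by auto
    then show ?thesis
      using face_lcm_eq_iff[OF \<tau> Suc.prems(2)] by blast
  next
    case False
    then show ?thesis
      using face_lcm_eq_iff[OF \<tau> Suc.prems(2)] Suc.IH[OF less_imp_le[OF j] \<tau> False] by auto
  qed
  have "\<sigma> \<notin> \<Union>(pruned_edges gens (Suc j)) \<longleftrightarrow> \<sigma> \<notin> \<Union>(pruned_edges gens j) \<and>
      \<not> (face_lcm gens ?\<tau> = face_lcm gens \<sigma> \<and> ?\<tau> \<notin> \<Union>(pruned_edges gens j))"
    using pruned_edges_Suc_iff[of \<sigma> gens j] Suc.prems(2) j by (simp only: length_gens) blast
  also have "\<dots> \<longleftrightarrow> survives_to \<sigma> ?r (Suc ?c) (cells \<sigma>)"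
    unfolding survives_next_col[of ?r ?c] tog eq Suc.IH[OF less_imp_le[OF j] Suc.prems(2,3)] ..
  also have "\<dots> \<longleftrightarrow> survives_to \<sigma> (Suc j div m) (Suc j mod m) (cells \<sigma>)"
  proof (cases "Suc ?c = m")
    case True
    then show ?thesis
      using survives_next_row[OF rows_cols(2)[OF Suc.prems(2)], of ?r] by (simp add: div_Suc mod_Suc)
  next
    case False
    then show ?thesis
      using m by (simp add: div_Suc mod_Suc)
  qed
  finally show ?case .
qed

lemma critical_iff:
  assumes "\<sigma> \<subseteq> {..<n * m}"
  shows "\<sigma> \<in> critical_faces gens \<longleftrightarrow>
    \<sigma> = {} \<or> cells \<sigma> = row_set \<sigma> \<times> {Min (col_set \<sigma>)} \<union> {Max (row_set \<sigma>)} \<times> col_set \<sigma>"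
proof (cases "\<sigma> = {}")
  case True
  then show ?thesis
    using empty_not_pruned[of "n * m"] by (simp add: critical_faces_def)
next
  case False
  interpret position_face "row_set \<sigma>" "col_set \<sigma>" "Min (col_set \<sigma>)" "Max (row_set \<sigma>)" "cells \<sigma>"
    using False assms by (intro position_face)
  \<comment> \<open>A nonempty face gives m > 0, so the final step number n * m corresponds to
    position (n, 0), just past the last row.\<close>
  obtain j where "j \<in> \<sigma>"
    using False by blast
  then have "0 < m"
    using assms by (cases "m = 0") auto
  then show ?thesis
    using False assms not_pruned_iff[of "n * m" \<sigma>] survives_end[OF rows_cols(1)[OF assms]]
    by (simp add: critical_faces_def)
qed

text \<open>The two arms share exactly the corner (M, b).\<close>

lemma card_hook:
  assumes "finite A" "finite B" "(b::nat) \<in> B" "(M::nat) \<in> A"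
  shows "Suc (card (A \<times> {b} \<union> {M} \<times> B)) = card A + card B"
proof -
  have "A \<times> {b} \<inter> {M} \<times> B = {(M, b)}"
    using assms by auto
  then show ?thesis
    using card_Un_Int[of "A \<times> {b}" "{M} \<times> B"] assms by (simp add: card_cartesian_product)
qed

lemma card_vertices:
  assumes "\<sigma> \<subseteq> {..<n * m}"
  shows "card (vertices \<sigma>) = card (row_set \<sigma>) + card (col_set \<sigma>)"
proof -
  have "(!) xs ` row_set \<sigma> \<inter> (!) ys ` col_set \<sigma> = {}"
    unfolding vertices_inter[OF assms, symmetric] using disjoint by blast
  moreover have "card ((!) xs ` row_set \<sigma>) = card (row_set \<sigma>)" "card ((!) ys ` col_set \<sigma>) = card (col_set \<sigma>)"
    using inj_nth rows_cols[OF assms] by (meson card_image inj_on_subset)+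
  ultimately show ?thesis
    unfolding vertices_def using rows_cols[OF assms] by (simp add: card_Un_disjoint)
qed

lemma card_critical:
  assumes "\<sigma> \<in> critical_faces gens" "\<sigma> \<noteq> {}"
  shows "Suc (card \<sigma>) = card (vertices \<sigma>)"
proof -
  have \<sigma>: "\<sigma> \<subseteq> {..<n * m}"
    using assms by (auto simp: critical_faces_def)
  interpret position_face "row_set \<sigma>" "col_set \<sigma>" "Min (col_set \<sigma>)" "Max (row_set \<sigma>)" "cells \<sigma>"
    using assms(2) \<sigma> by (intro position_face)
  have "card \<sigma> = card (cells \<sigma>)"
    by (simp add: card_image inj_on_subset[OF inj_position])
  also have "cells \<sigma> = row_set \<sigma> \<times> {Min (col_set \<sigma>)} \<union> {Max (row_set \<sigma>)} \<times> col_set \<sigma>"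
    using critical_iff[OF \<sigma>] assms by simp
  finally show ?thesis
    using card_hook[of "row_set \<sigma>" "col_set \<sigma>", OF _ _ b(1) M(1)] rows_cols[OF \<sigma>] card_vertices[OF \<sigma>] by simp
qed

text \<open>The lcm determines rows and columns, and these determine the hook.\<close>

lemma critical_unique:
  assumes "\<sigma> \<in> critical_faces gens" "\<tau> \<in> critical_faces gens" "face_lcm gens \<sigma> = face_lcm gens \<tau>"
  shows "\<sigma> = \<tau>"
proof -
  have s: "\<sigma> \<subseteq> {..<n * m}" "\<tau> \<subseteq> {..<n * m}"
    using assms by (auto simp: critical_faces_def)
  then have eq: "row_set \<sigma> = row_set \<tau>" "col_set \<sigma> = col_set \<tau>"
    using assms(3) by (simp_all add: face_lcm_eq_iff)
  have "cells \<sigma> = cells \<tau>"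
  proof (cases "\<sigma> = {}")
    case True
    then show ?thesis
      using eq by auto
  next
    case False
    then have "\<tau> \<noteq> {}"
      using eq by auto
    then show ?thesis
      using False assms critical_iff s eq by metis
  qed
  then show ?thesis
    by (simp add: inj_image_eq_iff[OF inj_position])
qed

lemma critical_exists:
  assumes "C \<subseteq> set xs \<union> set ys" "C \<inter> set xs \<noteq> {}" "C \<inter> set ys \<noteq> {}"
  obtains \<sigma> where "\<sigma> \<in> critical_faces gens" "\<sigma> \<noteq> {}" "vertices \<sigma> = C"
proof -
  define A where "A = {a. a < n \<and> xs ! a \<in> C}"
  define B where "B = {y. y < m \<and> ys ! y \<in> C}"
  have AB: "finite A" "finite B" "A \<noteq> {}" "B \<noteq> {}" "A \<subseteq> {..<n}" "B \<subseteq> {..<m}"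
    using assms by (auto simp: A_def B_def in_set_conv_nth)
  define H where "H = A \<times> {Min B} \<union> {Max A} \<times> B"
  define \<sigma> where "\<sigma> = (\<lambda>(a, y). a * m + y) ` H"
  have H: "a < n \<and> y < m" if "(a, y) \<in> H" for a y
  proof -
    have "a \<in> A \<and> y \<in> B"
      using that Min_in[OF AB(2,4)] Max_in[OF AB(1,3)] unfolding H_def by blast
    then show ?thesis
      using AB(5,6) by blast
  qed
  have "position m (a * m + y) = (a, y)" if "(a, y) \<in> H" for a y
    using H[OF that] by (cases "ys = []") (simp_all add: position_def)
  then have "(\<lambda>p. position m (case p of (a, y) \<Rightarrow> a * m + y)) ` H = id ` H"
    by (intro image_cong) auto
  then have cells: "cells \<sigma> = H"
    by (simp add: \<sigma>_def image_image)
  have "a * m + y < n * m" if "a < n" "y < m" for a y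
  proof -
    have "a * m + y < Suc a * m"
      using that by simp
    also have "\<dots> \<le> n * m"
      using that by (intro mult_right_mono) auto
    finally show ?thesis .
  qed
  then have sub: "\<sigma> \<subseteq> {..<n * m}"
    using H by (auto simp: \<sigma>_def)
  have rc: "row_set \<sigma> = A" "col_set \<sigma> = B"
  proof -
    have "row_set \<sigma> = A \<union> {Max A}" "col_set \<sigma> = {Min B} \<union> B"
      unfolding cells H_def image_Un using AB(3,4) by (simp_all add: fst_image_times snd_image_times)
    then show "row_set \<sigma> = A" "col_set \<sigma> = B"
      using Min_in[OF AB(2,4)] Max_in[OF AB(1,3)] by (simp_all only: insert_absorb Un_insert_right Un_insert_left Un_empty_right Un_empty_left)
  qed
  have ne: "\<sigma> \<noteq> {}"
    using rc AB by auto
  have "\<sigma> \<in> critical_faces gens"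
    unfolding critical_iff[OF sub] rc unfolding cells H_def by simp
  moreover have "vertices \<sigma> = C"
  proof -
    have "(!) xs ` A = C \<inter> set xs" "(!) ys ` B = C \<inter> set ys"
      by (auto simp: A_def B_def in_set_conv_nth)
    then show ?thesis
      unfolding vertices_def rc using assms by blast
  qed
  ultimately show ?thesis
    using ne that by blast
qed

text \<open>By \<open>critical_unique\<close> the count is an indicator. The empty face gives the
  first disjunct; the hook belonging to C gives the second and has one position fewer than C has
  vertices.\<close>

lemma pruned_betti_gens:
  "pruned_betti gens i \<alpha> = of_bool ((i = 0 \<and> \<alpha> = 0) \<or>
    (\<exists>C \<subseteq> set xs \<union> set ys. C \<inter> set xs \<noteq> {} \<and> C \<inter> set ys \<noteq> {} \<and> card C = Suc i \<and>
      multidegree (set_exp C) = \<alpha>))" (is "_ = of_bool ?R")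
proof -
  let ?S = "{\<sigma> \<in> critical_faces gens. card \<sigma> = i \<and> multidegree (face_lcm gens \<sigma>) = \<alpha>}"
  have sub: "\<sigma> \<subseteq> {..<n * m}" if "\<sigma> \<in> critical_faces gens" for \<sigma>
    using that by (auto simp: critical_faces_def)
  have unique: "\<sigma> = \<tau>" if "\<sigma> \<in> ?S" "\<tau> \<in> ?S" for \<sigma> \<tau>
    using that critical_unique[of \<sigma> \<tau>] by (metis (mono_tags, lifting) mem_Collect_eq multidegree_eq_iff)
  have "?S \<noteq> {} \<longleftrightarrow> ?R"
  proof
    assume "?S \<noteq> {}"
    then obtain \<sigma> where \<sigma>: "\<sigma> \<in> critical_faces gens" "card \<sigma> = i" "multidegree (face_lcm gens \<sigma>) = \<alpha>"
      by blast
    show ?R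
    proof (cases "\<sigma> = {}")
      case True
      then show ?thesis
        using \<sigma> by (auto simp: face_lcm_gens vertices_def)
    next
      case False
      have "vertices \<sigma> \<inter> set xs \<noteq> {}" "vertices \<sigma> \<inter> set ys \<noteq> {}"
        using False vertices_inter[OF sub[OF \<sigma>(1)]] by auto
      moreover have "vertices \<sigma> \<subseteq> set xs \<union> set ys"
        using vertices_inter[OF sub[OF \<sigma>(1)]] unfolding vertices_def by blast
      ultimately show ?thesis
        using card_critical[OF \<sigma>(1) False] \<sigma> face_lcm_gens[OF sub[OF \<sigma>(1)]] by auto
    qed
  next
    assume ?R
    then consider "i = 0 \<and> \<alpha> = 0"
      | C where "C \<subseteq> set xs \<union> set ys" "C \<inter> set xs \<noteq> {}" "C \<inter> set ys \<noteq> {}" "card C = Suc i"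
        "multidegree (set_exp C) = \<alpha>"
      by blast
    then show "?S \<noteq> {}"
    proof cases
      case 1
      then have "{} \<in> ?S"
        using critical_iff[of "{}"] face_lcm_gens[of "{}"] by (simp add: vertices_def)
      then show ?thesis
        by blast
    next
      case (2 C)
      obtain \<sigma> where \<sigma>: "\<sigma> \<in> critical_faces gens" "\<sigma> \<noteq> {}" "vertices \<sigma> = C"
        using critical_exists[OF 2(1-3)] .
      then have "\<sigma> \<in> ?S"
        using 2 card_critical[OF \<sigma>(1,2)] face_lcm_gens[OF sub[OF \<sigma>(1)]] by simp
      then show ?thesis
        by blast
    qed
  qed
  moreover have "card ?S = of_bool (?S \<noteq> {})"
  proof (cases "?S = {}")
    case True
    then show ?thesis
      by (simp only: card.empty) simp
  next
    case False
    then obtain \<sigma> where "\<sigma> \<in> ?S"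
      by blast
    then have "?S = {\<sigma>}"
      using unique by blast
    then show ?thesis
      by simp
  qed
  ultimately show ?thesis
    unfolding pruned_betti_def by simp
qed

lemma gens_distinct: "distinct gens"
proof -
  have "inj_on (\<lambda>j. {xs ! (j div m), ys ! (j mod m)}) {..<n * m}"
  proof (rule inj_onI)
    fix i j assume ij: "i \<in> {..<n * m}" "j \<in> {..<n * m}"
      and eq: "{xs ! (i div m), ys ! (i mod m)} = {xs ! (j div m), ys ! (j mod m)}"
    \<comment> \<open>The vertices of a one-element face form the edge of its generator, so
      injectivity is a case of \<open>vertices_eq_iff\<close>.\<close>
    have "vertices {k} = {xs ! (k div m), ys ! (k mod m)}" for k
      by (auto simp: vertices_def position_def)
    then have "vertices {i} = vertices {j}"
      using eq by simp
    then have "row_set {i} = row_set {j} \<and> col_set {i} = col_set {j}"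
      using ij vertices_eq_iff[of "{i}" "{j}"] by blast
    then have "position m i = position m j"
      by (simp add: prod_eq_iff)
    then show "i = j"
      by (rule injD[OF inj_position])
  qed
  then show ?thesis
    by (simp add: grid_gens_def distinct_map inj_on_def atLeast0LessThan)
qed

lemma gens_set: "set gens = (\<lambda>(x, y). set_exp {x, y}) ` (set xs \<times> set ys)"
proof (intro subset_antisym subsetI)
  fix a assume "a \<in> set gens"
  then obtain j where j: "j < n * m" "a = set_exp {xs ! (j div m), ys ! (j mod m)}"
    by (auto simp: grid_gens_def)
  have "row_set {j} \<subseteq> {..<n}" "col_set {j} \<subseteq> {..<m}"
    using rows_cols[of "{j}"] j(1) by simp_all
  then have "xs ! (j div m) \<in> set xs" "ys ! (j mod m) \<in> set ys"
    by (simp_all add: position_def)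
  with j(2) show "a \<in> (\<lambda>(x, y). set_exp {x, y}) ` (set xs \<times> set ys)"
    by auto
next
  fix a assume "a \<in> (\<lambda>(x, y). set_exp {x, y}) ` (set xs \<times> set ys)"
  then obtain r c where rc: "r < n" "c < m" "a = set_exp {xs ! r, ys ! c}"
    by (auto simp: in_set_conv_nth)
  have "r * m + c < Suc r * m"
    using rc by simp
  also have "\<dots> \<le> n * m"
    using rc by (intro mult_right_mono) auto
  finally have "r * m + c < n * m" .
  moreover have "(r * m + c) div m = r" "(r * m + c) mod m = c"
    using rc by (cases "ys = []"; simp)+
  ultimately show "a \<in> set gens"
    using rc(3) by (force simp: grid_gens_def)
qed

end

section \<open>Ideals generated by monomials\<close>

lemma module_mult: "Modules.module ((*) :: 'a::comm_ring_1 \<Rightarrow> 'a \<Rightarrow> 'a)"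
  by unfold_locales (simp_all add: algebra_simps)

lemma poly_sum_singles: "p = (\<Sum>a\<in>Poly_Mapping.keys p. Poly_Mapping.single a (Poly_Mapping.lookup p a))"
proof (rule poly_mapping_eqI)
  fix b
  have "(\<Sum>a\<in>Poly_Mapping.keys p. Poly_Mapping.lookup (Poly_Mapping.single a (Poly_Mapping.lookup p a)) b)
      = (\<Sum>a\<in>Poly_Mapping.keys p. if a = b then Poly_Mapping.lookup p b else 0)"
    by (intro sum.cong) (auto simp: lookup_single when_def)
  also have "\<dots> = Poly_Mapping.lookup p b"
    by (simp add: in_keys_iff)
  finally show "Poly_Mapping.lookup p b
      = Poly_Mapping.lookup (\<Sum>a\<in>Poly_Mapping.keys p. Poly_Mapping.single a (Poly_Mapping.lookup p a)) b"
    by (simp add: lookup_sum)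
qed

text \<open>The exponents above some element of A are closed under addition of exponents, so the
  polynomials supported there form an ideal; conversely each of their terms is a multiple of a
  generator.\<close>

lemma ideal_gen_power_products_iff:
  "p \<in> ideal_gen (power_product ` A) \<longleftrightarrow> (\<forall>a \<in> Poly_Mapping.keys p. \<exists>b \<in> A. b \<le> a)"
proof
  let ?T = "{p :: ('a, 'b) mpoly. \<forall>a \<in> Poly_Mapping.keys p. \<exists>b \<in> A. b \<le> a}"
  have "Modules.module.subspace (*) ?T"
    unfolding Modules.module.subspace_def[OF module_mult]
  proof (intro conjI ballI allI)
    fix p q assume "p \<in> ?T" "q \<in> ?T"
    then show "p + q \<in> ?T"
      using keys_add[of p q] by blast
  next
    fix r p assume p: "p \<in> ?T"
    have "\<exists>b \<in> A. b \<le> a" if a: "a \<in> Poly_Mapping.keys (r * p)" for a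
    proof -
      obtain a' a'' where "a = a' + a''" "a'' \<in> Poly_Mapping.keys p"
        using keys_mult[of r p] a by blast
      moreover then obtain b where "b \<in> A" "b \<le> a''"
        using p by blast
      ultimately show ?thesis
        by (intro bexI[of _ b]) (auto simp: le_fun_def trans_le_add2)
    qed
    then show "r * p \<in> ?T"
      by blast
  qed simp
  moreover have "power_product ` A \<subseteq> ?T"
    by (auto simp: power_product_def)
  ultimately have "ideal_gen (power_product ` A) \<subseteq> ?T"
    unfolding ideal_gen_def by (intro Modules.module.span_minimal[OF module_mult])
  then show "p \<in> ideal_gen (power_product ` A) \<Longrightarrow> \<forall>a \<in> Poly_Mapping.keys p. \<exists>b \<in> A. b \<le> a"
    by blast
next
  assume *: "\<forall>a \<in> Poly_Mapping.keys p. \<exists>b \<in> A. b \<le> a"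
  have "Poly_Mapping.single a c \<in> ideal_gen (power_product ` A)" if "a \<in> Poly_Mapping.keys p"
    for a and c :: 'b
  proof -
    obtain b where b: "b \<in> A" "b \<le> a"
      using * \<open>a \<in> Poly_Mapping.keys p\<close> by blast
    have "(a - b) + b = a"
      using b(2) by (simp add: le_fun_def fun_eq_iff)
    moreover have "Poly_Mapping.single (a - b) c * power_product b = Poly_Mapping.single ((a - b) + b) c"
      by (simp add: power_product_def mult_single)
    ultimately have "Poly_Mapping.single a c = Poly_Mapping.single (a - b) c * power_product b"
      by (simp only:)
    then show ?thesis
      unfolding ideal_gen_def using b(1)
      by (simp add: Modules.module.span_scale[OF module_mult] Modules.module.span_base[OF module_mult])
  qed
  then have "(\<Sum>a\<in>Poly_Mapping.keys p. Poly_Mapping.single a (Poly_Mapping.lookup p a))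
      \<in> ideal_gen (power_product ` A)"
    unfolding ideal_gen_def by (intro Modules.module.span_sum[OF module_mult])
  then show "p \<in> ideal_gen (power_product ` A)"
    unfolding poly_sum_singles[symmetric] .
qed

lemma power_product_mem_iff:
  "power_product a \<in> ideal_gen (power_product ` A) \<longleftrightarrow> (\<exists>b \<in> A. b \<le> a)"
  unfolding ideal_gen_power_products_iff by (simp add: power_product_def)

lemma graded_ideal_power_products: "graded_ideal (ideal_gen (power_product ` A))"
  unfolding graded_ideal_def
proof (intro conjI ballI allI)
  show "p + q \<in> ideal_gen (power_product ` A)"
    if "p \<in> ideal_gen (power_product ` A)" "q \<in> ideal_gen (power_product ` A)" for p q
    using that unfolding ideal_gen_def by (rule Modules.module.span_add[OF module_mult])
  show "r * p \<in> ideal_gen (power_product ` A)" if "p \<in> ideal_gen (power_product ` A)" for p r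
    using that unfolding ideal_gen_def by (rule Modules.module.span_scale[OF module_mult])
  show "hom_comp \<alpha> p \<in> ideal_gen (power_product ` A)" if "p \<in> ideal_gen (power_product ` A)" for p \<alpha>
    using that unfolding ideal_gen_power_products_iff by (auto simp: in_keys_iff lookup_hom_comp)
qed (simp add: ideal_gen_def Modules.module.span_zero[OF module_mult])

lemma var_mult_var:
  assumes "u \<noteq> v" shows "var u * var v = power_product (set_exp {u, v})"
proof -
  have "(\<lambda>w. if w = u then 1 else 0) + (\<lambda>w. if w = v then 1 else 0) = set_exp {u, v}"
    using assms by (auto simp: set_exp_def fun_eq_iff)
  then show ?thesis
    by (simp add: var_def power_product_def mult_single)
qed

lemma edge_ideal_bipartite:
  assumes "X \<inter> Y = {}"
  shows "(edge_ideal {{x, y} | x y. x \<in> X \<and> y \<in> Y} :: ('v, 'k::field) mpoly set)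
    = ideal_gen (power_product ` (\<lambda>(x, y). set_exp {x, y}) ` (X \<times> Y))"
proof -
  have "{var u * var v :: ('v, 'k) mpoly | u v. {u, v} \<in> {{x, y} | x y. x \<in> X \<and> y \<in> Y}}
      = power_product ` (\<lambda>(x, y). set_exp {x, y}) ` (X \<times> Y)" (is "?L = ?R")
  proof (intro subset_antisym subsetI)
    fix p assume "p \<in> ?L"
    then obtain u v x y where uv: "p = var u * var v" "{u, v} = {x, y}" "x \<in> X" "y \<in> Y"
      by blast
    then have "u \<noteq> v"
      using assms by (auto simp: doubleton_eq_iff)
    then have "p = power_product (set_exp {x, y})"
      using uv(1) unfolding uv(2)[symmetric] by (simp add: var_mult_var)
    then show "p \<in> ?R"
      using uv by auto
  next
    fix p assume "p \<in> ?R"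
    then obtain x y where xy: "x \<in> X" "y \<in> Y" "p = power_product (set_exp {x, y})"
      by auto
    then have "x \<noteq> y"
      using assms by blast
    then have "p = var x * var y"
      using xy by (simp add: var_mult_var)
    then show "p \<in> ?L"
      using xy by blast
  qed
  then show ?thesis
    by (simp add: edge_ideal_def)
qed

text \<open>If one edge monomial divides another, disjointness of X and Y forces both endpoints to
  agree.\<close>

lemma min_gens_bipartite:
  assumes "X \<inter> Y = {}"
  shows "min_gens (ideal_gen (power_product ` (\<lambda>(x, y). set_exp {x, y}) ` (X \<times> Y)))
    = (\<lambda>(x, y). set_exp {x, y}) ` (X \<times> Y)"
proof (intro subset_antisym subsetI)
  let ?A = "(\<lambda>(x, y). set_exp {x, y}) ` (X \<times> Y)"
  fix a assume "a \<in> min_gens (ideal_gen (power_product ` ?A))"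
  then have a: "\<exists>b \<in> ?A. b \<le> a" "\<And>b. \<exists>b' \<in> ?A. b' \<le> b \<Longrightarrow> b \<le> a \<Longrightarrow> b = a"
    unfolding min_gens_def power_product_mem_iff by blast+
  then obtain b where "b \<in> ?A" "b \<le> a"
    by blast
  with a(2)[of b] show "a \<in> ?A"
    by blast
next
  let ?A = "(\<lambda>(x, y). set_exp {x, y}) ` (X \<times> Y)"
  fix a assume a: "a \<in> ?A"
  then obtain x y where xy: "x \<in> X" "y \<in> Y" "a = set_exp {x, y}"
    by auto
  have "b = a" if b: "\<exists>b' \<in> ?A. b' \<le> b" "b \<le> a" for b
  proof -
    obtain x' y' where xy': "x' \<in> X" "y' \<in> Y" "set_exp {x', y'} \<le> b"
      using b by auto
    then have le: "set_exp {x', y'} \<le> set_exp {x, y}"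
      using b(2) xy(3) by auto
    then have "x' \<in> {x, y}" "y' \<in> {x, y}"
      unfolding set_exp_le_iff by (auto simp: set_exp_def)
    then have "x' = x" "y' = y"
      using xy xy' assms by auto
    then show ?thesis
      using xy'(3) b(2) xy(3) by simp
  qed
  then show "a \<in> min_gens (ideal_gen (power_product ` ?A))"
    unfolding min_gens_def power_product_mem_iff using a by blast
qed

section \<open>Simplicial chains meeting both sides\<close>

text \<open>The injective numbering supplies orientation signs, and \<open>dummy\<close> fixes the
  coefficient field.\<close>

locale vertex_order =
  fixes idx :: "'v::finite \<Rightarrow> nat" and dummy :: "'k::field itself"
  assumes inj_idx: "inj idx"
begin

definition incidence :: "'v \<Rightarrow> 'v set \<Rightarrow> 'k" where
  "incidence v B = (- 1) ^ card {u \<in> B. idx u < idx v}"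

text \<open>Chains are coefficient functions on all subsets, the empty one included, with all
  dimensions treated at once. This is the boundary of the augmented complex of the full
  simplex.\<close>

definition bd :: "('v set \<Rightarrow> 'k) \<Rightarrow> 'v set \<Rightarrow> 'k" where
  "bd z B = (\<Sum>v\<in>- B. incidence v B * z (insert v B))"

definition cone :: "'v \<Rightarrow> ('v set \<Rightarrow> 'k) \<Rightarrow> 'v set \<Rightarrow> 'k" where
  "cone s z C = (if s \<in> C then incidence s (C - {s}) * z (C - {s}) else 0)"

lemma incidence_square: "incidence v B * incidence v B = 1"
  by (simp add: incidence_def flip: power_add mult_2)

lemma incidence_insert:
  assumes "u \<notin> B" shows "incidence v (insert u B) = (if idx u < idx v then - incidence v B else incidence v B)"
proof (cases "idx u < idx v")
  case True
  then have "{w \<in> insert u B. idx w < idx v} = insert u {w \<in> B. idx w < idx v}"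
    by auto
  then show ?thesis
    using True assms by (simp add: incidence_def)
next
  case False
  then have "{w \<in> insert u B. idx w < idx v} = {w \<in> B. idx w < idx v}"
    by auto
  then show ?thesis
    using False by (simp add: incidence_def)
qed

text \<open>Exactly one of u and v precedes the other, so exactly one of the two insertions changes
  a sign.\<close>

lemma incidence_swap:
  assumes "u \<notin> B" "v \<notin> B" "u \<noteq> v"
  shows "incidence v B * incidence u (insert v B) = - (incidence u B * incidence v (insert u B))"
proof -
  have "idx u \<noteq> idx v"
    using inj_idx assms(3) by (auto dest: injD)
  then show ?thesis
    using assms by (auto simp: incidence_insert)
qed

lemma bd_bd: "bd (bd z) B = 0"
proof -
  define F where "F v u = incidence v B * incidence u (insert v B) * z (insert u (insert v B))" for u v
  let ?P = "\<lambda>R. {p \<in> (- B) \<times> (- B). R (idx (fst p)) (idx (snd p))}"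
  have anti: "F u v = - F v u" if "u \<notin> B" "v \<notin> B" "u \<noteq> v" for u v
    unfolding F_def using incidence_swap[OF that] by (simp add: insert_commute)
  have "bd (bd z) B = (\<Sum>v\<in>- B. \<Sum>u\<in>- insert v B. F v u)"
    by (simp add: bd_def F_def sum_distrib_left mult.assoc)
  also have "\<dots> = (\<Sum>(v, u)\<in>(SIGMA v:- B. - insert v B). F v u)"
    by (rule sum.Sigma) auto
  also have "(SIGMA v:- B. - insert v B) = ?P (<) \<union> ?P (>)"
    using inj_idx by (auto dest: injD simp: not_less le_less)
  also have "(\<Sum>(v, u)\<in>?P (<) \<union> ?P (>). F v u) = (\<Sum>(v, u)\<in>?P (<). F v u) + (\<Sum>(v, u)\<in>?P (>). F v u)"
    by (rule sum.union_disjoint) auto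
  also have "(\<Sum>(v, u)\<in>?P (>). F v u) = (\<Sum>(v, u)\<in>?P (<). F u v)"
    by (rule sum.reindex_bij_witness[of _ prod.swap prod.swap]) auto
  also have "\<dots> = (\<Sum>(v, u)\<in>?P (<). - F v u)"
  proof (rule sum.cong)
    fix p assume "p \<in> ?P (<)"
    then show "(case p of (v, u) \<Rightarrow> F u v) = (case p of (v, u) \<Rightarrow> - F v u)"
      by (cases p) (auto intro!: anti)
  qed simp
  also have "\<dots> = - (\<Sum>(v, u)\<in>?P (<). F v u)"
    by (simp add: sum_negf case_prod_beta)
  finally show ?thesis
    by simp
qed

text \<open>Joining with s is a contracting homotopy. If s lies in C, the term v = s of
  \<open>bd z (C - {s})\<close> returns \<open>z C\<close> and the others cancel; otherwise only v =
  s contributes.\<close>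

lemma bd_cone: "bd (cone s z) C + cone s (bd z) C = z C"
proof (cases "s \<in> C")
  case True
  define B where "B = C - {s}"
  have C: "C = insert s B" "s \<notin> B"
    using True by (auto simp: B_def)
  have "- B = insert s (- C)"
    using C by auto
  then have "bd z B = incidence s B * z C + (\<Sum>v\<in>- C. incidence v B * z (insert v B))"
    using True C(1) by (simp add: bd_def)
  then have "cone s (bd z) C = incidence s B * (incidence s B * z C) + (\<Sum>v\<in>- C. incidence s B * (incidence v B * z (insert v B)))"
    using True by (simp add: cone_def sum_distrib_left ring_distribs flip: B_def)
  moreover have "bd (cone s z) C = (\<Sum>v\<in>- C. - (incidence s B * (incidence v B * z (insert v B))))"
    unfolding bd_def
  proof (rule sum.cong)
    fix v assume "v \<in> - C"
    then have v: "v \<notin> B" "v \<noteq> s"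
      using C by auto
    then have "insert v C - {s} = insert v B"
      using C by auto
    then have "incidence v C * cone s z (insert v C) = incidence v (insert s B) * incidence s (insert v B) * z (insert v B)"
      using C by (simp add: cone_def)
    also have "incidence v (insert s B) * incidence s (insert v B) = - (incidence s B * incidence v B)"
      using incidence_swap[OF C(2) v(1) v(2)[symmetric]] incidence_insert[OF v(1), of s] incidence_insert[OF C(2), of v]
        inj_idx v(2) by (auto simp: mult.commute split: if_splits dest: injD)
    finally show "incidence v C * cone s z (insert v C) = - (incidence s B * (incidence v B * z (insert v B)))"
      by simp
  qed simp
  ultimately show ?thesis
    by (simp add: sum_negf incidence_square flip: mult.assoc)
next
  case False
  have "bd (cone s z) C = (\<Sum>v\<in>- C. if v = s then z C else 0)"
    unfolding bd_def
  proof (rule sum.cong)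
    fix v assume "v \<in> - C"
    then show "incidence v C * cone s z (insert v C) = (if v = s then z C else 0)"
      using False incidence_square[of s C] by (auto simp: cone_def simp flip: mult.assoc)
  qed simp
  then show ?thesis
    using False by (simp add: cone_def)
qed

lemma bd_add: "bd (\<lambda>C. z C + w C) B = bd z B + bd w B"
  by (simp add: bd_def ring_distribs sum.distrib)

lemma bd_diff: "bd (\<lambda>C. z C - w C) B = bd z B - bd w B"
  by (simp add: bd_def ring_distribs sum_subtractf)

lemma bd_eq_0I: "(\<And>v. v \<notin> B \<Longrightarrow> z (insert v B) = 0) \<Longrightarrow> bd z B = 0"
  by (auto simp: bd_def intro!: sum.neutral)

lemma bd_cong: "(\<And>v. v \<notin> B \<Longrightarrow> z (insert v B) = w (insert v B)) \<Longrightarrow> bd z B = bd w B"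
  by (auto simp: bd_def intro!: sum.cong)

lemma bd_cone_cycle:
  assumes "\<And>B. bd z B = 0" shows "bd (cone s z) C = z C"
proof -
  have "cone s (bd z) C = 0"
    by (simp add: cone_def assms)
  then show ?thesis
    using bd_cone[of s z C] by simp
qed

lemma bd_singletons: "bd z {} = (\<Sum>v\<in>UNIV. z {v})"
  by (simp add: bd_def incidence_def)

end

text \<open>The part of the simplicial chain complex on \<open>X \<union> Y\<close> spanned by the faces meeting both \<open>X\<close>
  and \<open>Y\<close> is the quotient by the subcomplex of faces inside \<open>X\<close> or inside \<open>Y\<close>. The last map \<open>aug\<close>
  measures the failure of the \<open>Y\<close>-part of the boundary to be a cycle.\<close>

locale bipartite_order = vertex_order idx dummy
  for idx :: "'v::finite \<Rightarrow> nat" and dummy :: "'k::field itself" +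
  fixes X Y :: "'v set"
  assumes cover: "X \<union> Y = UNIV" and disj: "X \<inter> Y = {}"
    and X_less_Y: "x \<in> X \<Longrightarrow> y \<in> Y \<Longrightarrow> idx x < idx y"
begin

definition meets :: "'v set \<Rightarrow> bool" where
  "meets C \<longleftrightarrow> C \<inter> X \<noteq> {} \<and> C \<inter> Y \<noteq> {}"

definition cell :: "nat \<Rightarrow> 'v set set" where
  "cell k = {C. meets C \<and> card C = k}"

definition aug :: "('v set \<Rightarrow> 'k) \<Rightarrow> 'k" where
  "aug z = (\<Sum>C\<in>cell 2. z C)"

abbreviation restrict_to :: "'v set \<Rightarrow> ('v set \<Rightarrow> 'k) \<Rightarrow> 'v set \<Rightarrow> 'k" where
  "restrict_to S z \<equiv> \<lambda>C. if C \<subseteq> S then z C else 0"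

lemma not_meets_iff: "\<not> meets C \<longleftrightarrow> C \<subseteq> X \<or> C \<subseteq> Y"
  using cover disj unfolding meets_def by blast

lemma cell_2: "cell 2 = (\<lambda>(x, y). {x, y}) ` (X \<times> Y)"
proof (intro subset_antisym subsetI)
  fix C assume "C \<in> cell 2"
  then obtain u v where "C = {u, v}" "meets C"
    by (auto simp: cell_def card_2_iff)
  then show "C \<in> (\<lambda>(x, y). {x, y}) ` (X \<times> Y)"
    using disj by (auto simp: meets_def image_iff insert_commute)
next
  fix C assume "C \<in> (\<lambda>(x, y). {x, y}) ` (X \<times> Y)"
  then obtain x y where "C = {x, y}" "x \<in> X" "y \<in> Y"
    by auto
  moreover then have "x \<noteq> y"
    using disj by auto
  ultimately show "C \<in> cell 2"
    by (auto simp: cell_def meets_def)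
qed

text \<open>The numbering puts X before Y, so every sign \<open>incidence x {y}\<close> is 1 and the
  plain sum over the edges is the augmentation of the Y-part of the boundary.\<close>

lemma aug_eq_bd:
  assumes z: "\<And>C. z C \<noteq> 0 \<Longrightarrow> meets C"
  shows "aug z = bd (restrict_to Y (bd z)) {}"
proof -
  have inj: "inj_on (\<lambda>(x, y). {x, y}) (X \<times> Y)"
    using disj by (auto simp: inj_on_def doubleton_eq_iff)
  have "bd z {y} = (\<Sum>x\<in>X. z {x, y})" if y: "y \<in> Y" for y
  proof -
    have "bd z {y} = (\<Sum>x\<in>X. incidence x {y} * z {x, y})"
      unfolding bd_def
    proof (rule sum.mono_neutral_right)
      show "\<forall>v \<in> - {y} - X. incidence v {y} * z (insert v {y}) = 0"
      proof
        fix v assume "v \<in> - {y} - X"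
        then have "\<not> meets {v, y}"
          using y cover unfolding not_meets_iff by auto
        then show "incidence v {y} * z (insert v {y}) = 0"
          using z by auto
      qed
    qed (use y disj in auto)
    also have "\<dots> = (\<Sum>x\<in>X. z {x, y})"
    proof (rule sum.cong)
      fix x assume "x \<in> X"
      then have "{u \<in> {y}. idx u < idx x} = {}"
        using X_less_Y[OF _ y] by (auto dest: less_asym)
      then show "incidence x {y} * z {x, y} = z {x, y}"
        by (simp only: incidence_def) simp
    qed simp
    finally show ?thesis .
  qed
  then have "(\<Sum>y\<in>Y. bd z {y}) = (\<Sum>y\<in>Y. \<Sum>x\<in>X. z {x, y})"
    by (intro sum.cong) auto
  also have "\<dots> = (\<Sum>(x, y)\<in>X \<times> Y. z {x, y})"
    by (subst sum.swap) (simp add: sum.cartesian_product)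
  also have "\<dots> = aug z"
    unfolding aug_def cell_2 using sum.reindex[OF inj, of z] by (simp add: case_prod_beta)
  finally have "aug z = (\<Sum>y\<in>Y. bd z {y})" ..
  also have "\<dots> = (\<Sum>v\<in>UNIV. restrict_to Y (bd z) {v})"
    by (rule sum.mono_neutral_cong_left) auto
  finally show ?thesis
    by (simp add: bd_singletons)
qed

lemma bd_restrict_eq_0:
  assumes "S \<in> {X, Y}" "\<not> B \<subseteq> S" shows "bd (restrict_to S z) B = 0"
  using assms(2) by (intro bd_eq_0I) auto

text \<open>Faces inside one side form a subcomplex, so discarding them does not affect coefficients
  at faces that meet both sides.\<close>

lemma bd_truncate:
  assumes "meets B" shows "bd (\<lambda>C. if meets C then z C else 0) B = bd z B"
  by (rule bd_cong) (use assms in \<open>auto simp: meets_def\<close>)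

text \<open>The two restrictions overlap only in the empty face, which is not a boundary term here because
  no vertex meets both sides.\<close>

lemma bd_split:
  assumes z: "\<And>C. z C \<noteq> 0 \<Longrightarrow> meets C"
  shows "bd z B = (if meets B then bd z B else 0) + (restrict_to X (bd z) B + restrict_to Y (bd z) B)"
proof -
  have "bd z {} = 0"
    by (rule bd_eq_0I) (use z disj in \<open>force simp: meets_def\<close>)
  moreover have "B = {}" if "B \<subseteq> X" "B \<subseteq> Y"
    using that disj by blast
  ultimately show ?thesis
    using not_meets_iff[of B] by auto
qed

text \<open>Split the boundary of z into q on meeting faces, p in X and r in Y. Since the sum is a
  cycle and p does not reach Y, the boundary of q on singletons of Y is minus that of r; a second
  boundary gives zero.\<close>

lemma aug_truncated_bd:
  assumes z: "\<And>C. z C \<noteq> 0 \<Longrightarrow> meets C"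
  shows "aug (\<lambda>C. if meets C then bd z C else 0) = 0"
proof -
  let ?q = "\<lambda>C. if meets C then bd z C else 0"
  let ?p = "restrict_to X (bd z)" and ?r = "restrict_to Y (bd z)"
  have "bd ?q B = - bd ?p B - bd ?r B" for B
  proof -
    have "bd (\<lambda>C. ?q C + (?p C + ?r C)) B = bd (bd z) B"
      by (rule bd_cong) (rule bd_split[OF z, symmetric])
    then show ?thesis
      unfolding bd_add bd_bd by (simp add: algebra_simps eq_neg_iff_add_eq_0)
  qed
  then have "bd ?q {y} = - bd ?r {y}" if "y \<in> Y" for y
    using bd_restrict_eq_0[where S = X and B = "{y}"] that disj by auto
  moreover have "bd ?r {x} = 0" if "x \<notin> Y" for x
    using bd_restrict_eq_0[where S = Y and B = "{x}"] that by auto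
  ultimately have "restrict_to Y (bd ?q) {v} = - bd ?r {v}" for v
    by auto
  then have "bd (restrict_to Y (bd ?q)) {} = - bd (bd ?r) {}"
    unfolding bd_singletons by (simp add: sum_negf)
  then show ?thesis
    by (subst aug_eq_bd) (auto simp: bd_bd split: if_splits)
qed

text \<open>The boundary of a relative cycle consists of p in X and r in Y. Each is a cycle by
  itself: a nonempty face cannot lie in both sides, and at the empty face \<open>aug z = 0\<close>
  is what is needed. Coning p from s and r from t turns z into an absolute cycle, which a further
  cone fills. The set U will be the support of a multidegree; it contains the apexes, so no vertex
  outside it enters.\<close>

lemma truncated_exact:
  assumes z: "\<And>C. z C \<noteq> 0 \<Longrightarrow> C \<in> cell k \<and> C \<subseteq> U" and st: "s \<in> X \<inter> U" "t \<in> Y \<inter> U"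
    and cycle: "\<And>B. meets B \<Longrightarrow> bd z B = 0" and aug: "aug z = 0"
  shows "\<exists>w. (\<forall>C. w C \<noteq> 0 \<longrightarrow> C \<in> cell (Suc k) \<and> C \<subseteq> U) \<and> (\<forall>B. meets B \<longrightarrow> bd w B = z B)"
proof -
  have zm: "\<And>C. z C \<noteq> 0 \<Longrightarrow> meets C"
    using z by (auto simp: cell_def)
  define p where "p = restrict_to X (bd z)"
  define r where "r = restrict_to Y (bd z)"
  have split: "bd z B = p B + r B" for B
  proof -
    have 0: "(if meets B then bd z B else 0) = 0"
      using cycle by simp
    show ?thesis
      unfolding p_def r_def using bd_split[of z B, OF zm] unfolding 0 add_0_left .
  qed
  have pr: "bd p B + bd r B = 0" for B
    unfolding bd_add[symmetric] split[symmetric] using bd_bd[of z B] by simp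
  have r0: "bd r B = 0" for B
  proof (cases "B = {}")
    case True
    then show ?thesis
      using aug aug_eq_bd[OF zm] by (simp add: r_def)
  next
    case False
    then consider "\<not> B \<subseteq> X" | "\<not> B \<subseteq> Y"
      using disj by blast
    then show ?thesis
    proof cases
      case 1
      then have "bd p B = 0"
        unfolding p_def by (intro bd_restrict_eq_0) auto
      then show ?thesis
        using pr[of B] by simp
    next
      case 2
      then show ?thesis
        unfolding r_def by (intro bd_restrict_eq_0) auto
    qed
  qed
  then have p0: "bd p B = 0" for B
    using pr[of B] by simp
  have bd_U: "C \<subseteq> U \<and> Suc (card C) = k" if "bd z C \<noteq> 0" for C
  proof -
    obtain v where "v \<notin> C" "z (insert v C) \<noteq> 0"
      using bd_eq_0I[of C z] \<open>bd z C \<noteq> 0\<close> by blast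
    then show ?thesis
      using z[of "insert v C"] by (auto simp: cell_def)
  qed
  \<comment> \<open>The two corrections live inside X and inside Y, so they are invisible on faces
    meeting both.\<close>
  define zz where "zz C = z C - cone s p C - cone t r C" for C
  have "bd zz B = 0" for B
    unfolding zz_def bd_diff using split bd_cone_cycle[OF p0] bd_cone_cycle[OF r0] by simp
  then have bd_zz: "bd (cone s zz) B = zz B" for B
    by (rule bd_cone_cycle)
  have cp: "cone s p C = 0" if "\<not> C \<subseteq> X" for C
  proof -
    have "\<not> C - {s} \<subseteq> X"
      using that st(1) by blast
    then show ?thesis
      by (simp add: cone_def p_def)
  qed
  have cr: "cone t r C = 0" if "\<not> C \<subseteq> Y" for C
  proof -
    have "\<not> C - {t} \<subseteq> Y"
      using that st(2) by blast
    then show ?thesis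
      by (simp add: cone_def r_def)
  qed
  have zz_supp: "C \<subseteq> U \<and> card C = k" if "zz C \<noteq> 0" for C
  proof -
    have supp: "C \<subseteq> U \<and> card C = k" if "cone u q C \<noteq> 0" "u \<in> U" "\<And>C. q C \<noteq> 0 \<Longrightarrow> bd z C \<noteq> 0" for u q
    proof -
      have "u \<in> C" "bd z (C - {u}) \<noteq> 0"
        using that by (auto simp: cone_def split: if_splits)
      moreover from this(1) have "Suc (card (C - {u})) = card C"
        by (intro card_Suc_Diff1) auto
      ultimately show ?thesis
        using bd_U[of "C - {u}"] that(2) by (metis insert_Diff insert_subset)
    qed
    have "p C \<noteq> 0 \<Longrightarrow> bd z C \<noteq> 0" "r C \<noteq> 0 \<Longrightarrow> bd z C \<noteq> 0" for C
      by (auto simp: p_def r_def split: if_splits)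
    note ps = supp[of s p, OF _ _ this(1)] and rs = supp[of t r, OF _ _ this(2)]
    consider "z C \<noteq> 0" | "cone s p C \<noteq> 0" | "cone t r C \<noteq> 0"
      using \<open>zz C \<noteq> 0\<close> by (cases "z C = 0"; cases "cone s p C = 0") (auto simp: zz_def)
    then show ?thesis
      using z[of C] ps rs st by cases (simp_all add: cell_def)
  qed
  \<comment> \<open>Truncation restores the required support, and \<open>bd_truncate\<close> keeps
    the boundary on meeting faces.\<close>
  define w where "w C = (if meets C then cone s zz C else 0)" for C
  have "C \<in> cell (Suc k) \<and> C \<subseteq> U" if "w C \<noteq> 0" for C
  proof -
    have "meets C" "s \<in> C" "zz (C - {s}) \<noteq> 0"
      using that by (auto simp: w_def cone_def split: if_splits)
    then show ?thesis
      using zz_supp[of "C - {s}"] st(1) card_Suc_Diff1[of C s] by (auto simp: cell_def)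
  qed
  moreover have "bd w B = z B" if B: "meets B" for B
  proof -
    have "bd w B = zz B"
      unfolding w_def bd_truncate[OF B] bd_zz ..
    then show ?thesis
      using cp[of B] cr[of B] B not_meets_iff[of B] by (auto simp: zz_def)
  qed
  ultimately show ?thesis
    by blast
qed

end

section \<open>The minimal resolution of the edge ideal\<close>

lemma count_list_distinct: "distinct xs \<Longrightarrow> count_list xs x = of_bool (x \<in> set xs)"
  by (induction xs) auto

section \<open>Multigraded strands of the polynomial complex\<close>

context bipartite_order
begin

text \<open>The Koszul differential in the coefficient form of \<open>bd\<close>; the variable v
  makes up for the degree lost when v leaves the face.\<close>

definition poly_bd :: "('v set \<Rightarrow> ('v, 'k) mpoly) \<Rightarrow> 'v set \<Rightarrow> ('v, 'k) mpoly" where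
  "poly_bd g B = (\<Sum>v\<in>- B. Poly_Mapping.single (set_exp {v}) (incidence v B) * g (insert v B))"

definition poly_aug :: "('v set \<Rightarrow> ('v, 'k) mpoly) \<Rightarrow> ('v, 'k) mpoly" where
  "poly_aug g = (\<Sum>C\<in>cell 2. power_product (set_exp C) * g C)"

text \<open>The component of multidegree \<alpha> as a chain over the field: the basis element of C
  has degree \<open>set_exp C\<close>, so its coefficient is read at the difference. The guard
  matters because subtraction of naturals truncates at 0.\<close>

definition strand :: "('v \<Rightarrow> nat) \<Rightarrow> ('v set \<Rightarrow> ('v, 'k) mpoly) \<Rightarrow> 'v set \<Rightarrow> 'k" where
  "strand \<alpha> g C = (if set_exp C \<le> \<alpha> then Poly_Mapping.lookup (g C) (\<alpha> - set_exp C) else 0)"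

lemma strand_nonzeroD: "strand \<alpha> g C \<noteq> 0 \<Longrightarrow> g C \<noteq> 0 \<and> C \<subseteq> {v. \<alpha> v \<noteq> 0}"
  by (auto simp: strand_def set_exp_le_iff split: if_splits)

lemma strand_inject:
  assumes "\<And>\<alpha>. strand \<alpha> g C = strand \<alpha> h C" shows "g C = h C"
proof (rule poly_mapping_eqI)
  fix \<beta>
  have "set_exp C \<le> \<beta> + set_exp C" "\<beta> + set_exp C - set_exp C = \<beta>"
    by (auto simp: le_fun_def fun_eq_iff)
  then show "Poly_Mapping.lookup (g C) \<beta> = Poly_Mapping.lookup (h C) \<beta>"
    using assms[of "\<beta> + set_exp C"] by (simp add: strand_def)
qed

text \<open>Multiplying by v raises the exponent by exactly what the face loses, so \<alpha> stays
  fixed and the variables disappear.\<close>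

lemma strand_poly_bd: "strand \<alpha> (poly_bd g) = bd (strand \<alpha> g)"
proof
  fix B
  show "strand \<alpha> (poly_bd g) B = bd (strand \<alpha> g) B"
  proof (cases "set_exp B \<le> \<alpha>")
    case True
    have "Poly_Mapping.lookup (Poly_Mapping.single (set_exp {v}) (incidence v B) * g (insert v B)) (\<alpha> - set_exp B)
        = incidence v B * strand \<alpha> g (insert v B)" if v: "v \<notin> B" for v
    proof -
      have "set_exp {v} \<le> \<alpha> - set_exp B \<longleftrightarrow> set_exp (insert v B) \<le> \<alpha>"
        using v True unfolding set_exp_le_iff by (auto simp: set_exp_def)
      moreover have "\<alpha> - set_exp B - set_exp {v} = \<alpha> - set_exp (insert v B)"
        unfolding set_exp_insert[OF v] by (auto simp: fun_eq_iff)
      ultimately show ?thesis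
        by (simp add: lookup_single_mult strand_def)
    qed
    then show ?thesis
      using True by (simp add: strand_def[of \<alpha> "poly_bd g"] poly_bd_def bd_def lookup_sum)
  next
    case False
    then have "\<not> set_exp (insert v B) \<le> \<alpha>" for v
      by (auto simp: set_exp_le_iff)
    then have "bd (strand \<alpha> g) B = 0"
      by (intro bd_eq_0I) (simp add: strand_def)
    then show ?thesis
      using False by (simp add: strand_def)
  qed
qed

lemma lookup_poly_aug: "Poly_Mapping.lookup (poly_aug g) \<alpha> = aug (strand \<alpha> g)"
  by (simp add: poly_aug_def aug_def lookup_sum power_product_def lookup_single_mult strand_def
      cong: if_cong)

lemma poly_bd_bd: "poly_bd (poly_bd g) B = 0"
  using strand_inject[of "poly_bd (poly_bd g)" B "\<lambda>_. 0"]
  by (simp add: strand_poly_bd bd_bd) (simp add: strand_def)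

lemma poly_aug_bd:
  assumes "\<And>C. g C \<noteq> 0 \<Longrightarrow> meets C" shows "poly_aug (poly_bd g) = 0"
proof (rule poly_mapping_eqI)
  fix \<alpha>
  have "aug (bd (strand \<alpha> g)) = aug (\<lambda>C. if meets C then bd (strand \<alpha> g) C else 0)"
    unfolding aug_def by (rule sum.cong) (auto simp: cell_def)
  also have "\<dots> = 0"
    using assms strand_nonzeroD by (intro aug_truncated_bd) blast
  finally show "Poly_Mapping.lookup (poly_aug (poly_bd g)) \<alpha> = Poly_Mapping.lookup 0 \<alpha>"
    by (simp add: lookup_poly_aug strand_poly_bd)
qed

lemma finite_strands: "finite {\<alpha>. \<exists>C. strand \<alpha> g C \<noteq> 0}"
proof (rule finite_subset)
  show "{\<alpha>. \<exists>C. strand \<alpha> g C \<noteq> 0} \<subseteq> (\<Union>C. (\<lambda>\<gamma>. \<gamma> + set_exp C) ` Poly_Mapping.keys (g C))"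
  proof
    fix \<alpha> assume "\<alpha> \<in> {\<alpha>. \<exists>C. strand \<alpha> g C \<noteq> 0}"
    then obtain C where C: "set_exp C \<le> \<alpha>" "\<alpha> - set_exp C \<in> Poly_Mapping.keys (g C)"
      by (auto simp: strand_def in_keys_iff split: if_splits)
    from C(1) have "\<alpha> = \<alpha> - set_exp C + set_exp C"
      by (simp add: le_fun_def fun_eq_iff)
    then have "\<alpha> \<in> (\<lambda>\<gamma>. \<gamma> + set_exp C) ` Poly_Mapping.keys (g C)"
      using C(2) by (rule image_eqI)
    then show "\<alpha> \<in> (\<Union>C. (\<lambda>\<gamma>. \<gamma> + set_exp C) ` Poly_Mapping.keys (g C))"
      by (rule UN_I[OF UNIV_I])
  qed
qed simp

text \<open>Finitely many nonzero strands contribute finitely many monomials to each coefficient,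
  and the support condition makes every exponent difference legitimate.\<close>

lemma chain_of_strands:
  assumes fin: "finite {\<alpha>. \<exists>C. w \<alpha> C \<noteq> 0}" and supp: "\<And>\<alpha> C. w \<alpha> C \<noteq> 0 \<Longrightarrow> C \<subseteq> {v. \<alpha> v \<noteq> 0}"
  obtains g where "\<And>\<alpha>. strand \<alpha> g = w \<alpha>"
proof -
  define g where "g C = Abs_poly_mapping (\<lambda>\<beta>. w (\<beta> + set_exp C) C)" for C
  have "finite {\<beta>. w (\<beta> + set_exp C) C \<noteq> 0}" for C
  proof (rule finite_subset)
    show "{\<beta>. w (\<beta> + set_exp C) C \<noteq> 0} \<subseteq> (\<lambda>\<alpha>. \<alpha> - set_exp C) ` {\<alpha>. \<exists>C. w \<alpha> C \<noteq> 0}"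
    proof
      fix \<beta> assume "\<beta> \<in> {\<beta>. w (\<beta> + set_exp C) C \<noteq> 0}"
      then show "\<beta> \<in> (\<lambda>\<alpha>. \<alpha> - set_exp C) ` {\<alpha>. \<exists>C. w \<alpha> C \<noteq> 0}"
        by (intro image_eqI[of _ _ "\<beta> + set_exp C"]) (auto simp: fun_eq_iff)
    qed
  qed (simp add: fin)
  then have lookup: "Poly_Mapping.lookup (g C) \<beta> = w (\<beta> + set_exp C) C" for C \<beta>
    by (simp add: g_def)
  have "strand \<alpha> g C = w \<alpha> C" for \<alpha> C
  proof (cases "set_exp C \<le> \<alpha>")
    case True
    then have "\<alpha> - set_exp C + set_exp C = \<alpha>"
      by (simp add: le_fun_def fun_eq_iff)
    then show ?thesis
      using True by (simp add: strand_def lookup)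
  next
    case False
    then have "w \<alpha> C = 0"
      using supp[of \<alpha> C] unfolding set_exp_le_iff by blast
    then show ?thesis
      using False by (simp add: strand_def)
  qed
  then show ?thesis
    using that by blast
qed

lemma poly_exact:
  assumes g: "\<And>C. g C \<noteq> 0 \<Longrightarrow> C \<in> cell k"
    and cycle: "\<And>B. meets B \<Longrightarrow> poly_bd g B = 0" and aug: "poly_aug g = 0"
  shows "\<exists>g'. \<forall>B. meets B \<longrightarrow> poly_bd g' B = g B"
proof -
  let ?U = "\<lambda>\<alpha> :: 'v \<Rightarrow> nat. {v. \<alpha> v \<noteq> 0}"
  \<comment> \<open>The first clause makes the filling of a zero strand zero. Hence only finitely
    many fillings are nonzero, and they assemble to polynomials.\<close>
  have "\<exists>w. ((\<exists>C. w C \<noteq> 0) \<longrightarrow> (\<exists>C. strand \<alpha> g C \<noteq> 0)) \<and>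
      (\<forall>C. w C \<noteq> 0 \<longrightarrow> C \<in> cell (Suc k) \<and> C \<subseteq> ?U \<alpha>) \<and> (\<forall>B. meets B \<longrightarrow> bd w B = strand \<alpha> g B)" for \<alpha>
  proof (cases "\<exists>C. strand \<alpha> g C \<noteq> 0")
    case False
    then show ?thesis
      by (intro exI[of _ "\<lambda>_. 0"]) (simp add: bd_def)
  next
    case True
    then obtain C where "C \<in> cell k" "C \<subseteq> ?U \<alpha>"
      using g strand_nonzeroD by blast
    \<comment> \<open>A nonzero strand has a face that meets both sides within the support of
      \<alpha>; this supplies the apexes of the cones.\<close>
    then obtain s t where "s \<in> X \<inter> ?U \<alpha>" "t \<in> Y \<inter> ?U \<alpha>"
      unfolding cell_def meets_def by blast
    moreover have "C \<in> cell k \<and> C \<subseteq> ?U \<alpha>" if "strand \<alpha> g C \<noteq> 0" for C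
      using strand_nonzeroD[OF that] g by blast
    moreover have "bd (strand \<alpha> g) B = 0" if "meets B" for B
      using cycle[OF that] by (simp add: strand_def flip: strand_poly_bd)
    moreover have "aug (strand \<alpha> g) = 0"
      using aug by (simp flip: lookup_poly_aug)
    ultimately obtain w where "\<forall>C. w C \<noteq> 0 \<longrightarrow> C \<in> cell (Suc k) \<and> C \<subseteq> ?U \<alpha>"
      "\<forall>B. meets B \<longrightarrow> bd w B = strand \<alpha> g B"
      using truncated_exact[of "strand \<alpha> g" k "?U \<alpha>" s t] by blast
    with True show ?thesis
      by blast
  qed
  then obtain w where w0: "\<And>\<alpha>. (\<exists>C. w \<alpha> C \<noteq> 0) \<Longrightarrow> (\<exists>C. strand \<alpha> g C \<noteq> 0)"
    and w: "\<And>\<alpha> C. w \<alpha> C \<noteq> 0 \<Longrightarrow> C \<in> cell (Suc k) \<and> C \<subseteq> ?U \<alpha>"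
    and bd: "\<And>\<alpha> B. meets B \<Longrightarrow> bd (w \<alpha>) B = strand \<alpha> g B"
    by metis
  have "finite {\<alpha>. \<exists>C. w \<alpha> C \<noteq> 0}"
    by (rule finite_subset[OF _ finite_strands[of g]]) (use w0 in blast)
  then obtain g' where g': "\<And>\<alpha>. strand \<alpha> g' = w \<alpha>"
    using chain_of_strands[of w] w by blast
  have "poly_bd g' B = g B" if "meets B" for B
    by (rule strand_inject) (simp add: strand_poly_bd g' bd[OF that])
  then show ?thesis
    by blast
qed

section \<open>Matrices of the resolution\<close>

definition cell_list :: "nat \<Rightarrow> 'v set list" where
  "cell_list k = (SOME Cs. set Cs = cell k \<and> distinct Cs)"

lemma cell_list: "set (cell_list k) = cell k" "distinct (cell_list k)"
proof -
  have "\<exists>Cs. set Cs = cell k \<and> distinct Cs"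
    by (rule finite_distinct_list) simp
  then have "set (cell_list k) = cell k \<and> distinct (cell_list k)"
    unfolding cell_list_def by (rule someI_ex)
  then show "set (cell_list k) = cell k" "distinct (cell_list k)"
    by blast+
qed

lemma cell_list_nth: "r < length (cell_list k) \<Longrightarrow> cell_list k ! r \<in> cell k"
  using cell_list(1) nth_mem by blast

lemma sum_cell_list: "(\<Sum>r<length (cell_list k). f (cell_list k ! r)) = (\<Sum>C\<in>cell k. f C)"
  using sum.reindex_bij_betw[OF bij_betw_nth[OF cell_list(2) refl cell_list(1)[symmetric]], of f] by simp

definition chain_vec :: "nat \<Rightarrow> ('v set \<Rightarrow> ('v, 'k) mpoly) \<Rightarrow> ('v, 'k) mpoly vec" where
  "chain_vec k g = vec (length (cell_list k)) (\<lambda>r. g (cell_list k ! r))"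

lemma chain_vec_carrier [simp]: "chain_vec k g \<in> carrier_vec (length (cell_list k))"
  by (simp add: chain_vec_def)

lemma chain_vec_cong: "(\<And>C. C \<in> cell k \<Longrightarrow> g C = h C) \<Longrightarrow> chain_vec k g = chain_vec k h"
  using cell_list_nth by (intro eq_vecI) (auto simp: chain_vec_def)

lemma chain_vec_eq_0_iff:
  "chain_vec k g = 0\<^sub>v (length (cell_list k)) \<longleftrightarrow> (\<forall>C \<in> cell k. g C = 0)"
proof
  assume *: "chain_vec k g = 0\<^sub>v (length (cell_list k))"
  show "\<forall>C \<in> cell k. g C = 0"
  proof
    fix C assume "C \<in> cell k"
    then obtain r where r: "r < length (cell_list k)" "C = cell_list k ! r"
      unfolding cell_list(1)[symmetric] in_set_conv_nth by blast
    have "chain_vec k g $ r = 0\<^sub>v (length (cell_list k)) $ r"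
      using * by simp
    with r show "g C = 0"
      by (simp add: chain_vec_def)
  qed
qed (use cell_list_nth in \<open>auto simp: chain_vec_def intro!: eq_vecI\<close>)

lemma chain_vec_surj:
  assumes "u \<in> carrier_vec (length (cell_list k))"
  shows "\<exists>g. u = chain_vec k g \<and> (\<forall>C. g C \<noteq> 0 \<longrightarrow> C \<in> cell k)"
proof -
  let ?L = "cell_list k"
  define g where "g C = (if C \<in> cell k then u $ inv_into {..<length ?L} ((!) ?L) C else 0)" for C
  have "inj_on ((!) ?L) {..<length ?L}"
    using cell_list(2) by (auto simp: inj_on_def nth_eq_iff_index_eq)
  then have "u = chain_vec k g"
    using assms cell_list_nth by (intro eq_vecI) (auto simp: chain_vec_def g_def inv_into_f_f)
  moreover have "\<forall>C. g C \<noteq> 0 \<longrightarrow> C \<in> cell k"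
    by (simp add: g_def)
  ultimately show ?thesis
    by blast
qed

text \<open>Homological degree i + 1 belongs to faces with i + 2 vertices, because the smallest
  meeting faces are the edges, that is the generators. The lists are empty once the size exceeds the
  number of vertices.\<close>

fun degrees :: "nat \<Rightarrow> ('v \<Rightarrow> int) list" where
  "degrees 0 = [0]"
| "degrees (Suc i) = map (\<lambda>C. multidegree (set_exp C)) (cell_list (i + 2))"

text \<open>Between cells of consecutive sizes the sum has a single term; a sum avoids having to
  name the missing vertex.\<close>

definition entry :: "'v set \<Rightarrow> 'v set \<Rightarrow> ('v, 'k) mpoly" where
  "entry B C = (if B \<subseteq> C then \<Sum>v\<in>C - B. Poly_Mapping.single (set_exp {v}) (incidence v B) else 0)"

fun differential :: "nat \<Rightarrow> ('v, 'k) mpoly mat" where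
  "differential 0 = mat 1 (length (cell_list 2)) (\<lambda>(r, c). power_product (set_exp (cell_list 2 ! c)))"
| "differential (Suc i) = mat (length (cell_list (i + 2))) (length (cell_list (i + 3)))
     (\<lambda>(r, c). entry (cell_list (i + 2) ! r) (cell_list (i + 3) ! c))"

lemma cell_cover:
  assumes "B \<in> cell k" "C \<in> cell (Suc k)" "B \<subseteq> C"
  obtains v where "v \<notin> B" "C = insert v B"
proof -
  have "card (C - B) = 1"
    using assms by (simp add: cell_def card_Diff_subset)
  then obtain v where "C - B = {v}"
    by (rule card_1_singletonE)
  then show ?thesis
    using that[of v] assms(3) by blast
qed

lemma insert_cell: "B \<in> cell k \<Longrightarrow> v \<notin> B \<Longrightarrow> insert v B \<in> cell (Suc k)"
  by (auto simp: cell_def meets_def)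

lemma entry_insert: "v \<notin> B \<Longrightarrow> entry B (insert v B) = Poly_Mapping.single (set_exp {v}) (incidence v B)"
  by (simp add: entry_def subset_insertI insert_Diff_if)

text \<open>Every superset of B with one more vertex still meets both sides, so restriction to cells
  loses no term of \<open>poly_bd\<close>.\<close>

lemma sum_entry:
  assumes B: "B \<in> cell k"
  shows "(\<Sum>C\<in>cell (Suc k). entry B C * g C) = poly_bd g B"
proof -
  have "poly_bd g B = (\<Sum>v\<in>- B. entry B (insert v B) * g (insert v B))"
    unfolding poly_bd_def by (intro sum.cong) (auto simp: entry_insert)
  also have "\<dots> = (\<Sum>C\<in>(\<lambda>v. insert v B) ` (- B). entry B C * g C)"
    by (subst sum.reindex) (auto simp: inj_on_def)
  also have "\<dots> = (\<Sum>C\<in>cell (Suc k). entry B C * g C)"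
  proof (rule sum.mono_neutral_left)
    show "(\<lambda>v. insert v B) ` (- B) \<subseteq> cell (Suc k)"
      using insert_cell[OF B] by blast
    show "\<forall>C \<in> cell (Suc k) - (\<lambda>v. insert v B) ` (- B). entry B C * g C = 0"
    proof
      fix C assume C: "C \<in> cell (Suc k) - (\<lambda>v. insert v B) ` (- B)"
      then have "\<not> B \<subseteq> C"
        using cell_cover[OF B, of C] by blast
      then show "entry B C * g C = 0"
        by (simp add: entry_def)
    qed
  qed simp
  finally show ?thesis ..
qed

lemma differential_0_mult: "differential 0 *\<^sub>v chain_vec 2 g = vec 1 (\<lambda>_. poly_aug g)"
proof (rule eq_vecI)
  fix r assume "r < dim_vec (vec 1 (\<lambda>_. poly_aug g))"
  then show "(differential 0 *\<^sub>v chain_vec 2 g) $ r = vec 1 (\<lambda>_. poly_aug g) $ r"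
    using sum_cell_list[of "\<lambda>C. power_product (set_exp C) * g C" 2]
    by (simp add: scalar_prod_def chain_vec_def atLeast0LessThan poly_aug_def)
qed simp

lemma differential_Suc_mult:
  "differential (Suc i) *\<^sub>v chain_vec (i + 3) g = chain_vec (i + 2) (poly_bd g)"
proof (rule eq_vecI)
  fix r assume "r < dim_vec (chain_vec (i + 2) (poly_bd g))"
  then have r: "r < length (cell_list (i + 2))"
    by (simp add: chain_vec_def)
  let ?B = "cell_list (i + 2) ! r"
  have "(differential (Suc i) *\<^sub>v chain_vec (i + 3) g) $ r = (\<Sum>C\<in>cell (i + 3). entry ?B C * g C)"
    using r sum_cell_list[of "\<lambda>C. entry ?B C * g C" "i + 3"]
    by (simp add: scalar_prod_def chain_vec_def atLeast0LessThan)
  also have "\<dots> = poly_bd g ?B"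
    using sum_entry[OF cell_list_nth[OF r], of g] by (simp add: numeral_eq_Suc)
  finally show "(differential (Suc i) *\<^sub>v chain_vec (i + 3) g) $ r = chain_vec (i + 2) (poly_bd g) $ r"
    using r by (simp add: chain_vec_def)
qed (simp add: chain_vec_def)

lemma differential_1_mult: "differential 1 *\<^sub>v chain_vec 3 g = chain_vec 2 (poly_bd g)"
  using differential_Suc_mult[of 0 g] by (simp only: add_0 One_nat_def)

lemma differential_Suc_Suc_mult:
  "differential (Suc (Suc i)) *\<^sub>v chain_vec (i + 4) g = chain_vec (i + 3) (poly_bd g)"
proof -
  have "Suc i + 3 = i + 4" "Suc i + 2 = i + 3"
    by simp_all
  then show ?thesis
    using differential_Suc_mult[of "Suc i" g] by (simp only:)
qed

lemma differential_carrier: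
  "differential i \<in> carrier_mat (length (degrees i)) (length (degrees (Suc i)))"
  by (cases i) (simp_all add: numeral_eq_Suc)

text \<open>Every nonzero entry is, up to sign, a variable or the monomial of an edge.\<close>

lemma differential_entry:
  assumes "r < length (degrees i)" "c < length (degrees (Suc i))"
  shows "homogeneous (degrees (Suc i) ! c - degrees i ! r) (differential i $$ (r, c))"
    and "Poly_Mapping.lookup (differential i $$ (r, c)) 0 = 0"
proof -
  have "homogeneous (degrees (Suc i) ! c - degrees i ! r) (differential i $$ (r, c)) \<and>
    Poly_Mapping.lookup (differential i $$ (r, c)) 0 = 0"
  proof (cases i)
    case 0
    then have c: "c < length (cell_list 2)"
      using assms by (simp add: numeral_eq_Suc)
    then have "cell_list 2 ! c \<noteq> {}"
      using cell_list_nth[OF c] by (auto simp: cell_def)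
    then show ?thesis
      using assms c 0 homogeneous_single[of "set_exp (cell_list 2 ! c)" "1 :: 'k"]
      by (simp add: power_product_def lookup_single numeral_eq_Suc)
  next
    case (Suc j)
    let ?B = "cell_list (j + 2) ! r" and ?C = "cell_list (j + 3) ! c"
    have rc: "r < length (cell_list (j + 2))" "c < length (cell_list (j + 3))"
      using assms Suc by (simp_all add: numeral_eq_Suc)
    have eq: "differential i $$ (r, c) = entry ?B ?C"
      "degrees (Suc i) ! c - degrees i ! r = multidegree (set_exp ?C) - multidegree (set_exp ?B)"
      using rc Suc by (simp_all add: numeral_eq_Suc)
    show ?thesis
    proof (cases "?B \<subseteq> ?C")
      case True
      have "?B \<in> cell (j + 2)" "?C \<in> cell (Suc (j + 2))"
        using cell_list_nth rc by (force simp: numeral_eq_Suc)+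
      then obtain v where v: "v \<notin> ?B" "?C = insert v ?B"
        using True by (rule cell_cover)
      have "multidegree (set_exp ?C) - multidegree (set_exp ?B) = multidegree (set_exp {v})"
        unfolding v(2) set_exp_insert[OF v(1)] by (simp add: multidegree_add)
      moreover have "entry ?B ?C = Poly_Mapping.single (set_exp {v}) (incidence v ?B)"
        unfolding v(2) by (rule entry_insert[OF v(1)])
      ultimately show ?thesis
        unfolding eq by (simp add: homogeneous_single lookup_single)
    next
      case False
      then show ?thesis
        unfolding eq by (simp add: entry_def)
    qed
  qed
  then show "homogeneous (degrees (Suc i) ! c - degrees i ! r) (differential i $$ (r, c))"
    "Poly_Mapping.lookup (differential i $$ (r, c)) 0 = 0"
    by blast+
qed

lemma kernel_differential_0:
  "mat_kernel (differential 0) = (\<lambda>u. differential 1 *\<^sub>v u) ` carrier_vec (length (cell_list 3))"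
proof (intro subset_antisym subsetI)
  fix u assume u: "u \<in> mat_kernel (differential 0)"
  then have "u \<in> carrier_vec (length (cell_list 2))"
    by (simp add: mat_kernel_def)
  then obtain g where g: "u = chain_vec 2 g" "\<And>C. g C \<noteq> 0 \<Longrightarrow> C \<in> cell 2"
    using chain_vec_surj by blast
  have "vec 1 (\<lambda>_. poly_aug g) = 0\<^sub>v 1"
    using u g(1) differential_0_mult[of g] by (simp add: mat_kernel_def)
  then have "vec 1 (\<lambda>_. poly_aug g) $ 0 = 0\<^sub>v 1 $ 0"
    by simp
  then have "poly_aug g = 0"
    by simp
  \<comment> \<open>A meeting face has at least two vertices, so its proper supersets lie beyond the
    support of g and the cycle condition is automatic.\<close>
  moreover have "poly_bd g B = 0" if B: "meets B" for B
  proof -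
    have "2 \<le> card B"
    proof -
      obtain x y where "{x, y} \<subseteq> B" "x \<noteq> y"
        using B disj unfolding meets_def by blast
      then show ?thesis
        using card_mono[of B "{x, y}"] by simp
    qed
    then have "g (insert v B) = 0" if "v \<notin> B" for v
      using g(2)[of "insert v B"] that by (auto simp: cell_def)
    then show ?thesis
      by (simp add: poly_bd_def)
  qed
  ultimately have "\<exists>g'. \<forall>B. meets B \<longrightarrow> poly_bd g' B = g B"
    using g(2) by (intro poly_exact)
  \<comment> \<open>Values of g' outside the cells with three vertices are irrelevant, since
    \<open>chain_vec\<close> does not read them.\<close>
  then obtain g' where "\<And>B. meets B \<Longrightarrow> poly_bd g' B = g B"
    by blast
  then have "u = chain_vec 2 (poly_bd g')"
    unfolding g(1) by (intro chain_vec_cong) (simp add: cell_def)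
  then have "u = differential 1 *\<^sub>v chain_vec 3 g'"
    by (simp only: differential_1_mult)
  then show "u \<in> (\<lambda>u. differential 1 *\<^sub>v u) ` carrier_vec (length (cell_list 3))"
    by (rule image_eqI) simp
next
  fix u assume "u \<in> (\<lambda>u. differential 1 *\<^sub>v u) ` carrier_vec (length (cell_list 3))"
  then obtain w where w: "w \<in> carrier_vec (length (cell_list 3))" "u = differential 1 *\<^sub>v w"
    by blast
  obtain g where g: "w = chain_vec 3 g" "\<And>C. g C \<noteq> 0 \<Longrightarrow> C \<in> cell 3"
    using chain_vec_surj[OF w(1)] by blast
  have u: "u = chain_vec 2 (poly_bd g)"
    using w(2) g(1) by (simp only: differential_1_mult)
  have "poly_aug (poly_bd g) = 0"
    by (rule poly_aug_bd) (use g(2) in \<open>auto simp: cell_def\<close>)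
  then have "differential 0 *\<^sub>v u = 0\<^sub>v 1"
    unfolding u differential_0_mult by (intro eq_vecI) simp_all
  then show "u \<in> mat_kernel (differential 0)"
    using u by (simp add: mat_kernel_def)
qed

lemma kernel_differential_Suc:
  "mat_kernel (differential (Suc i))
    = (\<lambda>u. differential (Suc (Suc i)) *\<^sub>v u) ` carrier_vec (length (cell_list (i + 4)))"
proof (intro subset_antisym subsetI)
  fix u assume u: "u \<in> mat_kernel (differential (Suc i))"
  then have "u \<in> carrier_vec (length (cell_list (i + 3)))"
    by (simp add: mat_kernel_def)
  then obtain g where g: "u = chain_vec (i + 3) g" "\<And>C. g C \<noteq> 0 \<Longrightarrow> C \<in> cell (i + 3)"
    using chain_vec_surj by blast
  have "chain_vec (i + 2) (poly_bd g) = 0\<^sub>v (length (cell_list (i + 2)))"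
    using u g(1) differential_Suc_mult[of i g] by (simp add: mat_kernel_def)
  then have cycle: "\<forall>B \<in> cell (i + 2). poly_bd g B = 0"
    by (simp only: chain_vec_eq_0_iff)
  \<comment> \<open>For a face of any other size the supersets with one more vertex carry
    coefficient zero.\<close>
  have "poly_bd g B = 0" if B: "meets B" for B
  proof (cases "B \<in> cell (i + 2)")
    case False
    then have "g (insert v B) = 0" if "v \<notin> B" for v
      using g(2)[of "insert v B"] that B by (auto simp: cell_def)
    then show ?thesis
      by (simp add: poly_bd_def)
  qed (use cycle in blast)
  \<comment> \<open>A cell with i + 3 vertices is never an edge, so the augmentation
    vanishes.\<close>
  moreover have "g C = 0" if "C \<in> cell 2" for C
    using g(2)[of C] that by (auto simp: cell_def)
  then have "poly_aug g = 0"
    by (simp add: poly_aug_def)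
  ultimately have "\<exists>g'. \<forall>B. meets B \<longrightarrow> poly_bd g' B = g B"
    using g(2) by (intro poly_exact)
  then obtain g' where "\<And>B. meets B \<Longrightarrow> poly_bd g' B = g B"
    by blast
  then have "u = chain_vec (i + 3) (poly_bd g')"
    unfolding g(1) by (intro chain_vec_cong) (simp add: cell_def)
  then have "u = differential (Suc (Suc i)) *\<^sub>v chain_vec (i + 4) g'"
    by (simp only: differential_Suc_Suc_mult)
  then show "u \<in> (\<lambda>u. differential (Suc (Suc i)) *\<^sub>v u) ` carrier_vec (length (cell_list (i + 4)))"
    by (rule image_eqI) simp
next
  fix u assume "u \<in> (\<lambda>u. differential (Suc (Suc i)) *\<^sub>v u) ` carrier_vec (length (cell_list (i + 4)))"
  then obtain w where w: "w \<in> carrier_vec (length (cell_list (i + 4)))" "u = differential (Suc (Suc i)) *\<^sub>v w"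
    by blast
  obtain g where g: "w = chain_vec (i + 4) g"
    using chain_vec_surj[OF w(1)] by blast
  have u: "u = chain_vec (i + 3) (poly_bd g)"
    using w(2) g by (simp only: differential_Suc_Suc_mult)
  have "differential (Suc i) *\<^sub>v u = 0\<^sub>v (length (cell_list (i + 2)))"
    unfolding u differential_Suc_mult chain_vec_eq_0_iff by (simp add: poly_bd_bd)
  then show "u \<in> mat_kernel (differential (Suc i))"
    using u by (simp add: mat_kernel_def)
qed

definition bipartite_ideal :: "('v, 'k) mpoly set" where
  "bipartite_ideal = ideal_gen (power_product ` set_exp ` cell 2)"

text \<open>The range of \<open>poly_aug\<close> is closed under sums and multiples and contains the
  generators. This is exactness at the free module of rank one.\<close>

lemma bipartite_ideal_iff: "p \<in> bipartite_ideal \<longleftrightarrow> (\<exists>g. p = poly_aug g)"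
proof
  have "Modules.module.subspace (*) (range poly_aug)"
    unfolding Modules.module.subspace_def[OF module_mult]
  proof (intro conjI ballI allI)
    show "0 \<in> range poly_aug"
      by (rule range_eqI[of _ _ "\<lambda>_. 0"]) (simp add: poly_aug_def)
  next
    fix p q assume "p \<in> range poly_aug" "q \<in> range poly_aug"
    then obtain g h where "p = poly_aug g" "q = poly_aug h"
      by blast
    then show "p + q \<in> range poly_aug"
      by (intro range_eqI[of _ _ "\<lambda>C. g C + h C"]) (simp add: poly_aug_def ring_distribs sum.distrib)
  next
    fix r p assume "p \<in> range poly_aug"
    then obtain g where "p = poly_aug g"
      by blast
    then show "r * p \<in> range poly_aug"
      by (intro range_eqI[of _ _ "\<lambda>C. r * g C"]) (simp add: poly_aug_def sum_distrib_left mult.left_commute)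
  qed
  moreover have "power_product (set_exp C) \<in> range poly_aug" if C: "C \<in> cell 2" for C
  proof (rule range_eqI)
    show "power_product (set_exp C) = poly_aug (\<lambda>C'. if C' = C then 1 else 0)"
      using C by (simp add: poly_aug_def if_distrib[of "\<lambda>x. _ * x"] cong: if_cong)
  qed
  ultimately have "bipartite_ideal \<subseteq> range poly_aug"
    unfolding bipartite_ideal_def ideal_gen_def
    by (intro Modules.module.span_minimal[OF module_mult]) auto
  then show "p \<in> bipartite_ideal \<Longrightarrow> \<exists>g. p = poly_aug g"
    by blast
next
  assume "\<exists>g. p = poly_aug g"
  then obtain g where "p = (\<Sum>C\<in>cell 2. g C * power_product (set_exp C))"
    by (auto simp: poly_aug_def mult.commute)
  moreover have "g C * power_product (set_exp C) \<in> bipartite_ideal" if "C \<in> cell 2" for C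
    unfolding bipartite_ideal_def ideal_gen_def using that
    by (intro Modules.module.span_scale[OF module_mult] Modules.module.span_base[OF module_mult]) blast
  ultimately show "p \<in> bipartite_ideal"
    unfolding bipartite_ideal_def ideal_gen_def by (simp only: Modules.module.span_sum[OF module_mult])
qed

lemma resolution:
  "minimal_graded_free_resolution UNIV bipartite_ideal degrees (vec 1 (\<lambda>_. 1)) differential"
  unfolding minimal_graded_free_resolution_def graded_free_resolution_def
proof (intro conjI allI impI)
  let ?e = "vec 1 (\<lambda>_. 1) :: ('v, 'k) mpoly vec"
  have e: "?e \<bullet> v = v $ 0" if "v \<in> carrier_vec 1" for v
    using that by (simp add: scalar_prod_def)
  show "?e \<in> carrier_vec (length (degrees 0))"
    by simp
  show "homogeneous (degrees 0 ! r) (?e $ r)" if "r < length (degrees 0)" for r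
    using that by simp
  show "differential i \<in> carrier_mat (length (degrees i)) (length (degrees (Suc i)))" for i
    by (rule differential_carrier)
  show "UNIV = {?e \<bullet> v + q | v q. v \<in> carrier_vec (length (degrees 0)) \<and> q \<in> bipartite_ideal}"
  proof (intro subset_antisym subsetI)
    fix p :: "('v, 'k) mpoly"
    have "0 \<in> bipartite_ideal"
      unfolding bipartite_ideal_iff by (intro exI[of _ "\<lambda>_. 0"]) (simp add: poly_aug_def)
    moreover have "p = ?e \<bullet> vec 1 (\<lambda>_. p) + 0"
      using e[of "vec 1 (\<lambda>_. p)"] by simp
    moreover have "vec 1 (\<lambda>_. p) \<in> carrier_vec (length (degrees 0))"
      by simp
    ultimately show "p \<in> {?e \<bullet> v + q | v q. v \<in> carrier_vec (length (degrees 0)) \<and> q \<in> bipartite_ideal}"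
      by blast
  qed simp
  show "{v \<in> carrier_vec (length (degrees 0)). ?e \<bullet> v \<in> bipartite_ideal}
      = (\<lambda>u. differential 0 *\<^sub>v u) ` carrier_vec (length (degrees 1))"
  proof (intro subset_antisym subsetI)
    fix v assume "v \<in> {v \<in> carrier_vec (length (degrees 0)). ?e \<bullet> v \<in> bipartite_ideal}"
    then have v: "v \<in> carrier_vec 1" "v $ 0 \<in> bipartite_ideal"
      using e by auto
    then obtain g where "v $ 0 = poly_aug g"
      unfolding bipartite_ideal_iff by blast
    then have "v = differential 0 *\<^sub>v chain_vec 2 g"
      unfolding differential_0_mult using v(1) by (intro eq_vecI) auto
    then show "v \<in> (\<lambda>u. differential 0 *\<^sub>v u) ` carrier_vec (length (degrees 1))"
      by (rule image_eqI) (simp add: numeral_eq_Suc chain_vec_def)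
  next
    fix v assume "v \<in> (\<lambda>u. differential 0 *\<^sub>v u) ` carrier_vec (length (degrees 1))"
    then obtain u where u: "u \<in> carrier_vec (length (cell_list 2))" "v = differential 0 *\<^sub>v u"
      by (auto simp: numeral_eq_Suc)
    obtain g where "u = chain_vec 2 g"
      using chain_vec_surj[OF u(1)] by blast
    then have "v = vec 1 (\<lambda>_. poly_aug g)"
      using u(2) differential_0_mult by simp
    then show "v \<in> {v \<in> carrier_vec (length (degrees 0)). ?e \<bullet> v \<in> bipartite_ideal}"
      using e[of v] bipartite_ideal_iff by auto
  qed
  show "mat_kernel (differential i)
      = (\<lambda>u. differential (Suc i) *\<^sub>v u) ` carrier_vec (length (degrees (Suc (Suc i))))" for i
    using kernel_differential_0 kernel_differential_Suc
    by (cases i) (simp_all add: numeral_eq_Suc)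
qed (use differential_entry in blast)+

lemma betti_quotient_bipartite_ideal:
  "betti_quotient bipartite_ideal i \<alpha> = of_bool ((i = 0 \<and> \<alpha> = 0) \<or>
    (\<exists>C. C \<inter> X \<noteq> {} \<and> C \<inter> Y \<noteq> {} \<and> card C = Suc i \<and> multidegree (set_exp C) = \<alpha>))"
proof -
  have "betti_quotient bipartite_ideal i \<alpha> = count_list (degrees i) \<alpha>"
    unfolding betti_quotient_def
    by (intro betti_eq_count[OF _ resolution]) (simp add: bipartite_ideal_def graded_ideal_power_products)
  also have "distinct (degrees i)"
    by (cases i) (auto simp: distinct_map cell_list(2) inj_on_def)
  then have "count_list (degrees i) \<alpha> = of_bool (\<alpha> \<in> set (degrees i))"
    by (rule count_list_distinct)
  also have "\<alpha> \<in> set (degrees i) \<longleftrightarrow> (i = 0 \<and> \<alpha> = 0) \<or>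
    (\<exists>C. C \<inter> X \<noteq> {} \<and> C \<inter> Y \<noteq> {} \<and> card C = Suc i \<and> multidegree (set_exp C) = \<alpha>)"
  proof (cases i)
    case 0
    \<comment> \<open>In degree 0 the second condition would ask for a single vertex lying on both
      sides.\<close>
    have "\<not> (C \<inter> X \<noteq> {} \<and> C \<inter> Y \<noteq> {} \<and> card C = Suc 0)" for C
      using disj by (auto simp: card_1_singleton_iff)
    then show ?thesis
      using 0 by auto
  next
    case (Suc j)
    then show ?thesis
      by (auto simp: cell_list(1) cell_def meets_def image_iff)
  qed
  finally show ?thesis .
qed

end

theorem corollary6p23:
  fixes E :: "'v::finite set set"
    and I :: "('v, 'k::field) mpoly set"
  assumes "complete_bipartite E"
    and "I = edge_ideal E"
  shows "admits_minimal_pruned_resolution I"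
proof -
  obtain X Y where cover: "X \<union> Y = UNIV" and disj: "X \<inter> Y = {}"
    and E: "E = {{x, y} | x y. x \<in> X \<and> y \<in> Y}"
    using assms(1) unfolding complete_bipartite_def by blast
  obtain xs where xs: "set xs = X" "distinct xs"
    using finite_distinct_list[of X] by auto
  obtain ys where ys: "set ys = Y" "distinct ys"
    using finite_distinct_list[of Y] by auto
  interpret vertex_lists xs ys
    using xs ys disj by unfold_locales auto
  obtain f :: "'v \<Rightarrow> nat" and b where f: "f ` UNIV = {i. i < b}" "inj f"
    using finite_imp_inj_to_nat_seg[of "UNIV :: 'v set"] by auto
  have fb: "f v < b" for v
    using f(1) by blast
  \<comment> \<open>Shifting Y by the bound b of f keeps the numbering injective and puts X before
    Y, as the signs behind \<open>aug\<close> require.\<close>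
  define idx where "idx v = (if v \<in> X then f v else b + f v)" for v
  interpret bipartite_order idx "TYPE('k)" X Y
  proof
    show "inj idx"
      using f(2) fb by (auto simp: inj_def idx_def) (metis not_add_less1)+
    show "idx x < idx y" if "x \<in> X" "y \<in> Y" for x y
      using that disj fb[of x] by (auto simp: idx_def)
  qed (fact cover disj)+
  have I: "I = ideal_gen (power_product ` (\<lambda>(x, y). set_exp {x, y}) ` (X \<times> Y))"
    unfolding assms(2) E by (rule edge_ideal_bipartite[OF disj])
  then have I': "I = bipartite_ideal"
    by (simp add: bipartite_ideal_def cell_2 image_image case_prod_beta)
  show ?thesis
  proof (rule pruned)
    show "monomial_ideal I"
      unfolding monomial_ideal_def using I by blast
    have "set gens = min_gens I"
      unfolding I min_gens_bipartite[OF disj] gens_set xs(1) ys(1) ..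
    moreover have "pruned_betti gens i \<alpha> = betti_quotient I i \<alpha>" for i \<alpha>
      unfolding pruned_betti_gens I' betti_quotient_bipartite_ideal xs(1) ys(1) cover by simp
    ultimately show "minimal_pruned_resolution I gens"
      unfolding minimal_pruned_resolution_def using gens_distinct by blast
  qed
qed

end
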